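(* For a finite set $P\subset\mathbb{R}^2$ and an integer $k\geq 1$, let $E_k(P)=|\{(p_1,q_1,\dots,p_k,q_k)\in P^{2k}: d(p_1,q_1)=\cdots=d(p_k,q_k)\}|$, where $d$ is the Euclidean distance. For a positive integer $N$ let $P_N=[\sqrt{N}]\times[\sqrt{N}]$, where $[x]=\{1,2,\dots,\lfloor x\rfloor\}$. Then for every integer $k\geq 2$ and all sufficiently large $N$ (depending on $k$), \[N^{k+1}(\log N)^{2^{k-1}-1}\gtrsim E_k(P_N)\gtrsim_k N^{k+1}(\log N)^{2^{k-1}-1}.\]
   Context: The notation $A\gtrsim B$ means $A\geq C\cdot B$ for some absolute constant $C>0$; $A\gtrsim_k B$ means $A\geq C_k\cdot B$ for a constant $C_k>0$ depending only on $k$. *)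

theory Defs
  imports "HOL-Analysis.Analysis" "HOL-Library.FuncSet"
begin

text \<open>The Euclidean plane is the product type \<open>real \<times> real\<close>, on which \<open>dist\<close> is the
  Euclidean distance; cf. \<open>dist_prod_def\<close>.\<close>

text \<open>A \<open>2k\<close>-tuple \<open>(p\<^sub>1, q\<^sub>1, \<dots>, p\<^sub>k, q\<^sub>k)\<close> is encoded as an extensional function
  \<open>i \<mapsto> (p\<^sub>i, q\<^sub>i)\<close> on the index set \<open>{1..k}\<close>. Degenerate pairs with \<open>p\<^sub>i = q\<^sub>i\<close> are counted.\<close>

definition dist_energy :: "nat \<Rightarrow> (real \<times> real) set \<Rightarrow> nat" where
  "dist_energy k P =
     card {t \<in> {1..k} \<rightarrow>\<^sub>E P \<times> P.
             \<forall>i\<in>{1..k}. \<forall>j\<in>{1..k}.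
               dist (fst (t i)) (snd (t i)) = dist (fst (t j)) (snd (t j))}"

definition int_segment :: "real \<Rightarrow> real set" where
  "int_segment x = real_of_int ` {1..\<lfloor>x\<rfloor>}"

definition square_grid :: "nat \<Rightarrow> (real \<times> real) set" where
  "square_grid N = int_segment (sqrt (real N)) \<times> int_segment (sqrt (real N))"

end

theory Submission
  imports Defs "HOL-Computational_Algebra.Euclidean_Algorithm"
begin

text \<open>A vector of squared length \<open>n > 0\<close> is the difference of at most \<open>N\<close> pairs of grid points, and
  of at least a fixed proportion of \<open>N\<close> if \<open>n\<close> is small compared to \<open>N\<close>. Hence \<open>E\<^sub>k\<close> is comparable
  to \<open>N ^ k\<close> times the number of \<open>k\<close>-tuples of Gaussian integers, up to units, of equal norm at
  most \<open>N\<close>. Put \<open>h = 2 ^ (k - 1)\<close>. Every such \<open>k\<close>-tuple arises from \<open>h\<close> Gaussian integers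
  \<open>z S\<close>, \<open>S \<subseteq> {1..<k}\<close>, whose norms multiply to the common norm: the \<open>j\<close>-th entry is the product
  of all \<open>z S\<close>, conjugated when \<open>j \<in> S\<close>. The number of such \<open>h\<close>-tuples with product of norms at
  most \<open>x\<close> has order \<open>x * ln x ^ (h - 1)\<close>, since the sum of \<open>1 / norm\<close> over norms up to \<open>x\<close> grows
  like \<open>ln x\<close>; this gives the upper bound. The parametrization is injective on those \<open>h\<close>-tuples
  that have no repeated prime factors up to conjugation. Every \<open>h\<close>-tuple is such a good one times
  factors from a family whose sum of inverse norms converges. The tail of that family accounts
  for less than half of all \<open>h\<close>-tuples, so the finitely many remaining factors show that the
  good ones form a positive proportion, which is the lower bound.\<close>

section \<open>The Gaussian integers as a Euclidean ring\<close>

datatype gint = GInt (gre: int) (gim: int)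

lemma gint_eqI: "gre x = gre y \<Longrightarrow> gim x = gim y \<Longrightarrow> x = y"
  by (cases x; cases y) simp

lemma gint_eq_iff: "x = y \<longleftrightarrow> gre x = gre y \<and> gim x = gim y"
  using gint_eqI by blast

instantiation gint :: idom
begin

definition zero_gint :: gint where "0 = GInt 0 0"
definition one_gint :: gint where "1 = GInt 1 0"
definition plus_gint :: "gint \<Rightarrow> gint \<Rightarrow> gint"
  where "x + y = GInt (gre x + gre y) (gim x + gim y)"
definition uminus_gint :: "gint \<Rightarrow> gint"
  where "- x = GInt (- gre x) (- gim x)"
definition minus_gint :: "gint \<Rightarrow> gint \<Rightarrow> gint"
  where "x - y = GInt (gre x - gre y) (gim x - gim y)"
definition times_gint :: "gint \<Rightarrow> gint \<Rightarrow> gint"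
  where "x * y = GInt (gre x * gre y - gim x * gim y) (gre x * gim y + gim x * gre y)"

lemma gre_gim_simps [simp]:
  "gre 0 = 0" "gim 0 = 0" "gre 1 = 1" "gim 1 = 0"
  "gre (x + y) = gre x + gre y" "gim (x + y) = gim x + gim y"
  "gre (- x) = - gre x" "gim (- x) = - gim x"
  "gre (x - y) = gre x - gre y" "gim (x - y) = gim x - gim y"
  "gre (x * y) = gre x * gre y - gim x * gim y"
  "gim (x * y) = gre x * gim y + gim x * gre y"
  by (simp_all add: zero_gint_def one_gint_def plus_gint_def uminus_gint_def minus_gint_def
      times_gint_def)

instance
proof
  fix x y :: gint
  assume xy: "x \<noteq> 0" "y \<noteq> 0"
  \<comment> \<open>The two-square identity: norms multiply, so a product of nonzero elements has
    nonzero norm.\<close>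
  have "(gre (x * y))\<^sup>2 + (gim (x * y))\<^sup>2 = ((gre x)\<^sup>2 + (gim x)\<^sup>2) * ((gre y)\<^sup>2 + (gim y)\<^sup>2)"
    by (simp add: algebra_simps power2_eq_square)
  moreover have "(gre x)\<^sup>2 + (gim x)\<^sup>2 \<noteq> 0" "(gre y)\<^sup>2 + (gim y)\<^sup>2 \<noteq> 0"
    using xy by (auto simp: gint_eq_iff)
  ultimately have "(gre (x * y))\<^sup>2 + (gim (x * y))\<^sup>2 \<noteq> 0" by simp
  then show "x * y \<noteq> 0" by (auto simp: gint_eq_iff)
qed (auto simp: gint_eq_iff algebra_simps)

end

definition gnorm :: "gint \<Rightarrow> nat"
  where "gnorm z = nat ((gre z)\<^sup>2 + (gim z)\<^sup>2)"

definition gcnj :: "gint \<Rightarrow> gint"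
  where "gcnj z = GInt (gre z) (- gim z)"

lemma gcnj_simps [simp]:
  "gre (gcnj z) = gre z" "gim (gcnj z) = - gim z" "gcnj 0 = 0" "gcnj 1 = 1"
  "gcnj (gcnj z) = z" "gcnj (x * y) = gcnj x * gcnj y"
  by (simp_all add: gcnj_def gint_eq_iff)

lemma gcnj_eq_0_iff [simp]: "gcnj z = 0 \<longleftrightarrow> z = 0"
  by (simp add: gint_eq_iff)

lemma int_gnorm: "int (gnorm z) = (gre z)\<^sup>2 + (gim z)\<^sup>2"
  by (simp add: gnorm_def)

lemma gnorm_mult [simp]: "gnorm (x * y) = gnorm x * gnorm y"
proof -
  have "int (gnorm (x * y)) = int (gnorm x * gnorm y)"
    by (simp add: int_gnorm power2_eq_square algebra_simps)
  then show ?thesis by (rule of_nat_eq_iff[THEN iffD1])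
qed

lemma gnorm_0 [simp]: "gnorm 0 = 0" and gnorm_1 [simp]: "gnorm 1 = 1"
  by (simp_all add: gnorm_def)

lemma gnorm_gcnj [simp]: "gnorm (gcnj z) = gnorm z"
  by (simp add: gnorm_def)

lemma gnorm_eq_0_iff [simp]: "gnorm z = 0 \<longleftrightarrow> z = 0"
proof -
  have "gnorm z = 0 \<longleftrightarrow> int (gnorm z) = 0" by simp
  also have "\<dots> \<longleftrightarrow> z = 0" unfolding int_gnorm by (simp add: gint_eq_iff)
  finally show ?thesis .
qed

lemma gnorm_pos_iff [simp]: "gnorm z > 0 \<longleftrightarrow> z \<noteq> 0"
  using gnorm_eq_0_iff[of z] by linarith

lemma mult_gcnj: "z * gcnj z = GInt (int (gnorm z)) 0"
  by (simp add: gint_eq_iff int_gnorm power2_eq_square)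

lemma gnorm_prod: "gnorm (\<Prod>i\<in>A. f i) = (\<Prod>i\<in>A. gnorm (f i))"
  by (induction A rule: infinite_finite_induct) simp_all

lemma gnorm_dvd: "x dvd y \<Longrightarrow> gnorm x dvd gnorm y"
  by (auto elim!: dvdE)

lemma gint_is_unit_iff: "z dvd 1 \<longleftrightarrow> gnorm z = 1"
proof
  assume "z dvd 1"
  from gnorm_dvd[OF this] show "gnorm z = 1" by simp
next
  assume "gnorm z = 1"
  then have "z * gcnj z = 1" by (simp add: mult_gcnj one_gint_def)
  then show "z dvd 1" by (metis dvd_triv_left)
qed

text \<open>For positive \<open>n\<close>, the integer nearest to \<open>a / n\<close>, as the floor
  of \<open>a / n + 1 / 2\<close>.\<close>

definition rdiv :: "int \<Rightarrow> int \<Rightarrow> int"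
  where "rdiv a n = (2 * a + n) div (2 * n)"

lemma rdiv_mult: "n > 0 \<Longrightarrow> rdiv (n * a) n = a"
proof -
  assume n: "n > 0"
  have "(2 * (n * a) + n) div (2 * n) = (n + a * (2 * n)) div (2 * n)"
    by (simp add: algebra_simps)
  also have "\<dots> = a" using n by (subst div_mult_self1) auto
  finally show ?thesis by (simp add: rdiv_def)
qed

lemma rdiv_bound: "n > 0 \<Longrightarrow> \<bar>2 * (a - rdiv a n * n)\<bar> \<le> n"
proof -
  assume n: "n > 0"
  have "(2 * a + n) div (2 * n) * (2 * n) + (2 * a + n) mod (2 * n) = 2 * a + n"
    by (rule div_mult_mod_eq)
  moreover have "0 \<le> (2 * a + n) mod (2 * n)" "(2 * a + n) mod (2 * n) < 2 * n"
    using n by simp_all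
  ultimately show ?thesis unfolding rdiv_def by (simp add: algebra_simps abs_le_iff)
qed

instantiation gint :: "{divide, modulo}"
begin

text \<open>The exact quotient is \<open>x * gcnj y\<close> divided by the integer
  \<open>gnorm y\<close>. Rounding both coordinates to nearest integers keeps the remainder
  small.\<close>

definition divide_gint :: "gint \<Rightarrow> gint \<Rightarrow> gint"
  where "x div y = (if y = 0 then 0 else
    GInt (rdiv (gre (x * gcnj y)) (int (gnorm y))) (rdiv (gim (x * gcnj y)) (int (gnorm y))))"
definition modulo_gint :: "gint \<Rightarrow> gint \<Rightarrow> gint"
  where "modulo_gint x y = x - x div y * y"

instance ..

end

instantiation gint :: euclidean_ring
begin

definition euclidean_size_gint :: "gint \<Rightarrow> nat"
  where "euclidean_size z = gnorm z"

instance
proof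
  fix x y :: gint
  show "x div 0 = 0" by (simp add: divide_gint_def)
  show "x div y * y + x mod y = x" by (simp add: modulo_gint_def)
  show "euclidean_size (0::gint) = 0" by (simp add: euclidean_size_gint_def)
  assume y: "y \<noteq> 0"
  then have pos: "int (gnorm y) > 0" by simp
  show "x * y div y = x"
  proof -
    have eq: "x * y * gcnj y = x * GInt (int (gnorm y)) 0"
      by (simp only: mult.assoc mult_gcnj)
    have "gre (x * y * gcnj y) = int (gnorm y) * gre x"
      "gim (x * y * gcnj y) = int (gnorm y) * gim x"
      unfolding eq by simp_all
    then show ?thesis using y by (simp only: divide_gint_def rdiv_mult[OF pos]) simp
  qed
  show "euclidean_size x \<le> euclidean_size (x * y)"
    using y by (simp add: euclidean_size_gint_def Suc_le_eq)
  show "euclidean_size (x mod y) < euclidean_size y"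
  proof -
    define n where "n = int (gnorm y)"
    define t where "t = x * gcnj y"
    define r where "r = (x mod y) * gcnj y"
    have "r = t - (x div y) * (y * gcnj y)"
      by (simp add: r_def t_def modulo_gint_def algebra_simps)
    then have r: "gre r = gre t - rdiv (gre t) n * n" "gim r = gim t - rdiv (gim t) n * n"
      using y unfolding mult_gcnj by (simp_all add: divide_gint_def t_def n_def)
    \<comment> \<open>Rounding leaves an error of at most \<open>n / 2\<close> in each coordinate of
      \<open>r\<close>, so \<open>gnorm r\<close> is at most \<open>n\<^sup>2 / 2\<close>. As
      \<open>gnorm r\<close> is \<open>n\<close> times the norm of the remainder, the latter is at
      most \<open>n / 2\<close>.\<close>
    have "(2 * gre r)\<^sup>2 \<le> n\<^sup>2" "(2 * gim r)\<^sup>2 \<le> n\<^sup>2"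
      using rdiv_bound[of n "gre t"] rdiv_bound[of n "gim t"] pos
      by (simp_all add: r n_def flip: abs_le_square_iff)
    then have "2 * int (gnorm r) \<le> n\<^sup>2" by (simp add: int_gnorm power_mult_distrib)
    moreover have "int (gnorm r) = int (gnorm (x mod y)) * n"
      by (simp add: r_def n_def)
    ultimately have "(2 * int (gnorm (x mod y))) * n \<le> n * n"
      by (simp add: power2_eq_square)
    then have "2 * int (gnorm (x mod y)) \<le> n"
      using pos by (simp add: n_def)
    moreover have "n > 0" using pos by (simp only: n_def)
    ultimately have "int (gnorm (x mod y)) < n" by linarith
    then show ?thesis by (simp add: euclidean_size_gint_def n_def)
  qed
qed

end

section \<open>Units and normalization to the first quadrant\<close>

instantiation gint :: normalization_euclidean_semiring
begin

text \<open>The four units rotate the half-open quadrant of positive real and nonnegative imaginary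
  part onto the four disjoint regions tested here, which cover all nonzero elements. The inverse of
  a unit is its conjugate, hence the formula for \<open>normalize\<close>.\<close>

definition unit_factor_gint :: "gint \<Rightarrow> gint"
  where "unit_factor z =
    (if z = 0 then 0
     else if gre z > 0 \<and> gim z \<ge> 0 then 1
     else if gre z \<le> 0 \<and> gim z > 0 then GInt 0 1
     else if gre z < 0 \<and> gim z \<le> 0 then - 1
     else GInt 0 (- 1))"
definition normalize_gint :: "gint \<Rightarrow> gint"
  where "normalize z = z * gcnj (unit_factor z)"

lemma gnorm_eq_1_cases:
  "gnorm z = 1 \<Longrightarrow> z = 1 \<or> z = - 1 \<or> z = GInt 0 1 \<or> z = GInt 0 (- 1)"
proof -
  assume "gnorm z = 1"
  then have *: "(gre z)\<^sup>2 + (gim z)\<^sup>2 = 1" using int_gnorm[of z] by simp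
  have "(gre z)\<^sup>2 \<le> 1\<^sup>2" "(gim z)\<^sup>2 \<le> 1\<^sup>2"
    unfolding one_power2 using * zero_le_power2[of "gre z"] zero_le_power2[of "gim z"]
    by linarith+
  then have "\<bar>gre z\<bar> \<le> 1" "\<bar>gim z\<bar> \<le> 1"
    by (auto simp only: abs_le_square_iff[symmetric])
  then have "gre z \<in> {-1, 0, 1}" "gim z \<in> {-1, 0, 1}" by auto
  then show ?thesis using * by (auto simp: gint_eq_iff)
qed

instance
proof
  fix a b :: gint
  show "unit_factor (0::gint) = 0" by (simp add: unit_factor_gint_def)
  show "normalize (0::gint) = 0" by (simp add: normalize_gint_def)
  show "unit_factor a * normalize a = a"
    by (auto simp: unit_factor_gint_def normalize_gint_def gint_eq_iff)
  show "a \<noteq> 0 \<Longrightarrow> unit_factor a dvd 1"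
    by (auto simp: unit_factor_gint_def gint_is_unit_iff gnorm_def)
  assume "a dvd 1"
  then have *: "a = 1 \<or> a = - 1 \<or> a = GInt 0 1 \<or> a = GInt 0 (- 1)"
    using gint_is_unit_iff gnorm_eq_1_cases by blast
  then show "unit_factor a = a"
    by (auto simp: unit_factor_gint_def gint_eq_iff)
  have "b = 0 \<or> (gre b > 0 \<and> gim b \<ge> 0) \<or> (gre b \<le> 0 \<and> gim b > 0) \<or>
      (gre b < 0 \<and> gim b \<le> 0) \<or> (gre b \<ge> 0 \<and> gim b < 0)"
    by (auto simp: gint_eq_iff)
  with * show "unit_factor (a * b) = a * unit_factor b"
    by (elim disjE) (simp_all add: unit_factor_gint_def gint_eq_iff)
qed

end

lemma normalize_gint_eq_iff: "z \<noteq> 0 \<Longrightarrow> normalize z = z \<longleftrightarrow> gre z > 0 \<and> gim z \<ge> 0" for z :: gint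
  by (auto simp: normalize_gint_def unit_factor_gint_def gint_eq_iff split: if_splits)

lemma gnorm_normalize [simp]: "gnorm (normalize z) = gnorm z"
proof (cases "z = 0")
  case False
  then have "gnorm (unit_factor z) = 1"
    using gint_is_unit_iff unit_factor_is_unit by blast
  moreover have "gnorm z = gnorm (unit_factor z) * gnorm (normalize z)"
    by (simp flip: gnorm_mult)
  ultimately show ?thesis by simp
qed simp

lemma gcnj_dvd_iff [simp]: "gcnj x dvd gcnj y \<longleftrightarrow> x dvd y"
proof -
  have "gcnj x dvd gcnj y" if "x dvd y" for x y using that by (auto elim!: dvdE)
  from this[of x y] this[of "gcnj x" "gcnj y"] show ?thesis by auto
qed

lemma prime_elem_gcnj [simp]: "prime_elem (gcnj p) \<longleftrightarrow> prime_elem p"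
proof -
  have "prime_elem (gcnj p)" if p: "prime_elem p" for p
  proof (rule prime_elemI)
    show "gcnj p \<noteq> 0" using p by auto
    show "\<not> gcnj p dvd 1" using p prime_elem_not_unit[OF p] by (simp add: gint_is_unit_iff)
    fix a b assume "gcnj p dvd a * b"
    then have "p dvd gcnj a * gcnj b" using gcnj_dvd_iff[of "gcnj p" "a * b"] by simp
    then have "p dvd gcnj a \<or> p dvd gcnj b" using p prime_elem_dvd_mult_iff by blast
    then show "gcnj p dvd a \<or> gcnj p dvd b"
      using gcnj_dvd_iff[of p "gcnj a"] gcnj_dvd_iff[of p "gcnj b"] by simp
  qed
  from this[of p] this[of "gcnj p"] show ?thesis by auto
qed

lemma gint_exists_prime_dvd:
  fixes z :: gint
  assumes "z \<noteq> 0" "gnorm z \<noteq> 1"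
  obtains p where "prime_elem p" "p dvd z" "gnorm p > 1"
proof -
  have "\<not> z dvd 1" using assms by (simp add: gint_is_unit_iff)
  then obtain p where p: "prime p" "p dvd z" using assms(1) prime_divisorE by blast
  then have "prime_elem p" by auto
  moreover have "gnorm p \<noteq> 0" "gnorm p \<noteq> 1"
    using \<open>prime_elem p\<close> prime_elem_not_unit[of p] gint_is_unit_iff[of p] by auto
  ultimately show thesis using p that[of p] by linarith
qed

lemma prime_elem_dvd_prodE:
  fixes f :: "'b \<Rightarrow> 'a :: algebraic_semidom"
  assumes "finite A" "prime_elem p" "p dvd prod f A"
  obtains i where "i \<in> A" "p dvd f i"
proof -
  have "\<exists>i\<in>A. p dvd f i"
    using assms(1,3)
  proof (induction A rule: finite_induct)
    case empty
    then show ?case using assms(2) by (simp add: prime_elem_not_unit)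
  next
    case (insert i A)
    then show ?case using assms(2) by (auto simp: prime_elem_dvd_mult_iff)
  qed
  then show thesis using that by blast
qed

lemma normalize_prod_cong:
  fixes f g :: "'b \<Rightarrow> 'a :: normalization_semidom"
  assumes "\<And>i. i \<in> A \<Longrightarrow> normalize (f i) = normalize (g i)"
  shows "normalize (\<Prod>i\<in>A. f i) = normalize (\<Prod>i\<in>A. g i)"
  using assms
proof (induction A rule: infinite_finite_induct)
  case (insert x A)
  have "normalize (f x * prod f A) = normalize (normalize (f x) * normalize (prod f A))" by simp
  also have "\<dots> = normalize (normalize (g x) * normalize (prod g A))"
    using insert by (simp del: normalize_mult_normalize_left normalize_mult_normalize_right)
  finally show ?case using insert by simp
qed simp_all

lemma normalize_mult_cong:
  fixes a b c d :: "'a :: normalization_semidom"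
  assumes "normalize a = normalize c" "normalize b = normalize d"
  shows "normalize (a * b) = normalize (c * d)"
  using assms by (metis normalize_mult_normalize_left normalize_mult_normalize_right)

lemma normalize_gcnj_cong:
  assumes "normalize x = normalize y"
  shows "normalize (gcnj x) = normalize (gcnj y)"
  using assms associated_iff_dvd gcnj_dvd_iff by metis

section \<open>Equal norms and factorizations\<close>

text \<open>Induction on the norm of \<open>w\<close>. A prime \<open>p\<close> of \<open>w\<close>
  divides \<open>z * gcnj z\<close>, hence \<open>z\<close> or \<open>gcnj z\<close>. In the first
  case it is collected in \<open>g\<close>, in the second in \<open>v\<close>, and it is cancelled
  from both \<open>w\<close> and \<open>z\<close>.\<close>

lemma gnorm_split_factor:
  assumes "w \<noteq> 0" "gnorm z = gnorm w * m"
  shows "\<exists>g v z'. w = g * v \<and> z = g * gcnj v * z'"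
  using assms
proof (induction "gnorm w" arbitrary: w z rule: less_induct)
  case less
  show ?case
  proof (cases "gnorm w = 1")
    case True
    then have "w dvd z" by (simp add: gint_is_unit_iff unit_imp_dvd)
    then obtain z' where "z = w * z'" by (elim dvdE)
    then show ?thesis by (intro exI[of _ w] exI[of _ 1] exI[of _ z']) simp
  next
    case False
    then obtain p where p: "prime_elem p" "p dvd w" "gnorm p > 1"
      using less.prems(1) gint_exists_prime_dvd by blast
    then obtain w1 where w1: "w = p * w1" by (elim dvdE)
    have w1_less: "w1 \<noteq> 0" "gnorm w1 < gnorm w" using less.prems(1) p(3) w1 by auto
    have "z * gcnj z = p * gcnj p * GInt (int (gnorm w1 * m)) 0"
      using less.prems(2) by (simp add: mult_gcnj w1 gint_eq_iff)
    then have "p dvd z * gcnj z" by (simp add: mult.assoc)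
    then have "p dvd z \<or> p dvd gcnj z" using p(1) prime_elem_dvd_mult_iff by blast
    then show ?thesis
    proof
      assume "p dvd z"
      then obtain z1 where z1: "z = p * z1" by (elim dvdE)
      have "gnorm z1 = gnorm w1 * m" using less.prems(2) p(3) by (auto simp: z1 w1 mult.assoc)
      from less.hyps[OF w1_less(2,1) this] obtain g v z'
        where "w1 = g * v" "z1 = g * gcnj v * z'" by blast
      then show ?thesis
        by (intro exI[of _ "p * g"] exI[of _ v] exI[of _ z']) (simp add: z1 w1 mult_ac)
    next
      assume "p dvd gcnj z"
      then have "gcnj p dvd z" using gcnj_dvd_iff[of p "gcnj z"] by simp
      then obtain z1 where z1: "z = gcnj p * z1" by (elim dvdE)
      have "gnorm z1 = gnorm w1 * m" using less.prems(2) p(3) by (auto simp: z1 w1 mult.assoc)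
      from less.hyps[OF w1_less(2,1) this] obtain g v z'
        where "w1 = g * v" "z1 = g * gcnj v * z'" by blast
      then show ?thesis
        by (intro exI[of _ g] exI[of _ "p * v"] exI[of _ z']) (simp add: z1 w1 mult_ac)
    qed
  qed
qed

text \<open>The \<open>z S\<close> are split off one at a time by \<open>gnorm_split_factor\<close>;
  the cofactor \<open>w0\<close> that remains has exactly the norm required for the other
  indices.\<close>

lemma gnorm_split_prod:
  assumes "finite I" "\<And>S. S \<in> I \<Longrightarrow> z S \<noteq> 0" "gnorm w = (\<Prod>S\<in>I. gnorm (z S)) * m"
  shows "\<exists>g v w'. (\<forall>S\<in>I. z S = g S * v S) \<and> w = (\<Prod>S\<in>I. g S * gcnj (v S)) * w'"
  using assms
proof (induction I arbitrary: w rule: finite_induct)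
  case empty
  then show ?case by simp
next
  case (insert S I)
  have "gnorm w = gnorm (z S) * ((\<Prod>S\<in>I. gnorm (z S)) * m)"
    using insert by (simp add: mult_ac)
  then obtain g0 v0 w0 where 0: "z S = g0 * v0" "w = g0 * gcnj v0 * w0"
    using gnorm_split_factor[of "z S"] insert.prems(1) by blast
  have "z S \<noteq> 0" using insert.prems(1) by blast
  then have "g0 \<noteq> 0" "v0 \<noteq> 0" using 0 by auto
  then have "gnorm w0 = (\<Prod>S\<in>I. gnorm (z S)) * m"
    using insert.hyps insert.prems(2) 0 by simp
  then obtain g v w' where gv: "\<forall>S\<in>I. z S = g S * v S" "w0 = (\<Prod>S\<in>I. g S * gcnj (v S)) * w'"
    using insert.IH insert.prems(1) by blast
  have *: "(\<Prod>U\<in>I. (g(S := g0)) U * gcnj ((v(S := v0)) U)) = (\<Prod>S\<in>I. g S * gcnj (v S))"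
    using insert.hyps by (intro prod.cong) auto
  have "(\<Prod>U\<in>insert S I. (g(S := g0)) U * gcnj ((v(S := v0)) U)) =
      g0 * gcnj v0 * (\<Prod>S\<in>I. g S * gcnj (v S))"
    using insert.hyps by (subst prod.insert) (auto simp only: * fun_upd_same)
  then have "w = (\<Prod>U\<in>insert S I. (g(S := g0)) U * gcnj ((v(S := v0)) U)) * w'"
    using 0 gv(2) by (simp only: mult.assoc)
  moreover have "\<forall>U\<in>insert S I. z U = (g(S := g0)) U * (v(S := v0)) U"
    using 0 gv(1) by auto
  ultimately show ?case by blast
qed

section \<open>Parametrization of tuples of equal norm\<close>

definition cnj_if :: "bool \<Rightarrow> gint \<Rightarrow> gint"
  where "cnj_if b z = (if b then gcnj z else z)"

lemma cnj_if_mult [simp]: "cnj_if b (x * y) = cnj_if b x * cnj_if b y"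
  and gnorm_cnj_if [simp]: "gnorm (cnj_if b x) = gnorm x"
  and cnj_if_dvd_iff [simp]: "cnj_if b x dvd cnj_if b y \<longleftrightarrow> x dvd y"
  and prime_elem_cnj_if [simp]: "prime_elem (cnj_if b x) \<longleftrightarrow> prime_elem x"
  by (simp_all add: cnj_if_def)

text \<open>The \<open>k\<close>-tuples of equal norm are parametrized by \<open>2 ^ (k - 1)\<close> free factors \<open>z S\<close>,
  \<open>S \<subseteq> {1..<k}\<close>: the \<open>j\<close>-th entry takes \<open>z S\<close> or its conjugate according to \<open>j \<in> S\<close>. Since
  \<open>0\<close> lies in no such \<open>S\<close>, the entry with index \<open>0\<close> is the plain product.\<close>

definition twist_prod :: "nat set set \<Rightarrow> (nat set \<Rightarrow> gint) \<Rightarrow> nat \<Rightarrow> gint"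
  where "twist_prod I z j = (\<Prod>S\<in>I. cnj_if (j \<in> S) (z S))"

lemma gnorm_twist_prod: "gnorm (twist_prod I z j) = (\<Prod>S\<in>I. gnorm (z S))"
  by (simp add: twist_prod_def gnorm_prod)

text \<open>Induction on \<open>k\<close>. The new entry \<open>w k\<close> has the norm of the
  product of the old factors, so these split as \<open>z S = g S * v S\<close> with
  \<open>w k\<close> associated to the product of all \<open>g S * gcnj (v S)\<close>. Old entries
  see only \<open>g S * v S\<close>; the new one conjugates exactly the \<open>v S\<close>.\<close>

lemma twist_prod_surj:
  assumes "k \<ge> 1" "n > 0" "\<And>j. j < k \<Longrightarrow> gnorm (w j) = n"
  shows "\<exists>z. (\<forall>S\<in>Pow {1..<k}. z S \<noteq> 0) \<and>
    (\<forall>j<k. normalize (twist_prod (Pow {1..<k}) z j) = normalize (w j))"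
  using assms(1,3)
proof (induction k rule: nat_induct_at_least)
  case base
  then show ?case using assms(2)
    by (intro exI[of _ "\<lambda>_. w 0"]) (auto simp: twist_prod_def cnj_if_def)
next
  case (Suc k)
  define I where "I = Pow {1..<k}"
  have I: "finite I" "\<And>S. S \<in> I \<Longrightarrow> k \<notin> S" by (auto simp: I_def)
  have "\<exists>z. (\<forall>S\<in>I. z S \<noteq> 0) \<and> (\<forall>j<k. normalize (twist_prod I z j) = normalize (w j))"
    unfolding I_def by (rule Suc.IH) (simp add: Suc.prems)
  then obtain z where z: "\<And>S. S \<in> I \<Longrightarrow> z S \<noteq> 0"
    "\<And>j. j < k \<Longrightarrow> normalize (twist_prod I z j) = normalize (w j)"
    by blast
  have "gnorm (normalize (twist_prod I z 0)) = n"
    using z(2)[of 0] Suc.hyps Suc.prems[of 0] by simp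
  then have n: "(\<Prod>S\<in>I. gnorm (z S)) = n" by (simp add: gnorm_twist_prod)
  moreover have "gnorm (w k) = n" using Suc.prems by simp
  ultimately obtain g v w' where gv: "\<forall>S\<in>I. z S = g S * v S"
    "w k = (\<Prod>S\<in>I. g S * gcnj (v S)) * w'"
    using gnorm_split_prod[of I z "w k" 1] I(1) z(1) by auto
  \<comment> \<open>The product already has the full norm \<open>n\<close>, so only a unit is left
    over.\<close>
  have "gnorm (\<Prod>S\<in>I. g S * gcnj (v S)) = n"
    using gv(1) n[symmetric] by (simp add: gnorm_prod)
  then have unit: "w' dvd 1"
    using gv(2) \<open>gnorm (w k) = n\<close> assms(2) by (simp add: gint_is_unit_iff)
  \<comment> \<open>Passing from \<open>k\<close> to \<open>k + 1\<close> doubles the index set: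
    \<open>S\<close> gets \<open>g S\<close> and \<open>insert k S\<close> gets
    \<open>v S\<close>.\<close>
  define z' where "z' S = (if k \<in> S then v (S - {k}) else g S)" for S
  have inj: "inj_on (insert k) I" using I(2) by (intro inj_onI) (metis insert_ident)
  have disj: "I \<inter> insert k ` I = {}" using I(2) by auto
  have "{1..<Suc k} = insert k {1..<k}" using Suc.hyps by auto
  then have Pow: "Pow {1..<Suc k} = I \<union> insert k ` I" by (simp add: Pow_insert I_def)
  have split: "twist_prod (Pow {1..<Suc k}) z' j =
      (\<Prod>S\<in>I. cnj_if (j \<in> S) (g S) * cnj_if (j = k \<or> j \<in> S) (v S))" for j
  proof -
    have "twist_prod (Pow {1..<Suc k}) z' j =
        (\<Prod>S\<in>I. cnj_if (j \<in> S) (z' S)) * (\<Prod>S\<in>I. cnj_if (j \<in> insert k S) (z' (insert k S)))"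
      unfolding twist_prod_def Pow using I(1) disj inj
      by (simp add: prod.union_disjoint prod.reindex)
    also have "\<dots> = (\<Prod>S\<in>I. cnj_if (j \<in> S) (z' S) * cnj_if (j \<in> insert k S) (z' (insert k S)))"
      by (simp add: prod.distrib)
    also have "\<dots> = (\<Prod>S\<in>I. cnj_if (j \<in> S) (g S) * cnj_if (j = k \<or> j \<in> S) (v S))"
      using I(2) by (intro prod.cong) (auto simp: z'_def)
    finally show ?thesis .
  qed
  have "normalize (twist_prod (Pow {1..<Suc k}) z' j) = normalize (w j)" if "j < Suc k" for j
  proof (cases "j = k")
    case True
    have "twist_prod (Pow {1..<Suc k}) z' j = (\<Prod>S\<in>I. g S * gcnj (v S))"
      unfolding split using I(2) True by (intro prod.cong) (auto simp: cnj_if_def)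
    then show ?thesis using True gv(2) unit by simp
  next
    case False
    have "twist_prod (Pow {1..<Suc k}) z' j = twist_prod I z j"
      unfolding split twist_prod_def[of I] using False gv(1) by (intro prod.cong) auto
    then show ?thesis using False that z(2) by simp
  qed
  moreover have "\<forall>S\<in>Pow {1..<Suc k}. z' S \<noteq> 0"
  proof -
    have "g S \<noteq> 0" "v S \<noteq> 0" if "S \<in> I" for S using gv(1) z(1)[OF that] that by auto
    then show ?thesis unfolding Pow z'_def using I(2) by auto
  qed
  ultimately show ?case by blast
qed

text \<open>The half-open first quadrant: one representative for each class of associated nonzero
  elements.\<close>

definition quad :: "gint set"
  where "quad = {z. z \<noteq> 0 \<and> normalize z = z}"

definition sphere_quad :: "nat \<Rightarrow> gint set"
  where "sphere_quad n = {z \<in> quad. gnorm z = n}"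

definition tuples :: "'b set \<Rightarrow> nat \<Rightarrow> ('b \<Rightarrow> gint) set"
  where "tuples I n = {z \<in> I \<rightarrow>\<^sub>E quad. (\<Prod>S\<in>I. gnorm (z S)) = n}"

lemma quad_gnorm_pos: "z \<in> quad \<Longrightarrow> gnorm z \<ge> 1"
  by (simp add: quad_def Suc_le_eq)

lemma finite_gnorm_le: "finite {z. gnorm z \<le> n}"
proof (rule finite_subset)
  show "{z. gnorm z \<le> n} \<subseteq> case_prod GInt ` ({- int n..int n} \<times> {- int n..int n})"
  proof
    fix z assume "z \<in> {z. gnorm z \<le> n}"
    then have "(gre z)\<^sup>2 + (gim z)\<^sup>2 \<le> int n" using int_gnorm[of z] by simp
    moreover have "\<bar>a\<bar> \<le> a\<^sup>2" for a :: int
      using self_le_power[of "\<bar>a\<bar>" 2] by (cases "a = 0") auto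
    ultimately have "\<bar>gre z\<bar> \<le> int n" "\<bar>gim z\<bar> \<le> int n"
      using zero_le_power2[of "gre z"] zero_le_power2[of "gim z"] by (smt (verit))+
    then show "z \<in> case_prod GInt ` ({- int n..int n} \<times> {- int n..int n})"
      by (intro image_eqI[of _ _ "(gre z, gim z)"]) (auto simp: abs_le_iff)
  qed
qed simp

lemma finite_sphere_quad [simp]: "finite (sphere_quad n)"
  by (rule finite_subset[OF _ finite_gnorm_le[of n]]) (auto simp: sphere_quad_def)

lemma prod_gnorm_quad:
  assumes "finite I" "z \<in> I \<rightarrow>\<^sub>E quad"
  shows "(\<Prod>S\<in>I. gnorm (z S)) \<ge> 1"
    and "S \<in> I \<Longrightarrow> gnorm (z S) \<le> (\<Prod>S\<in>I. gnorm (z S))"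
proof -
  have *: "gnorm (z S) \<ge> 1" if "S \<in> I" for S
    using assms(2) that quad_gnorm_pos by (metis PiE_mem)
  then show "(\<Prod>S\<in>I. gnorm (z S)) \<ge> 1" by (intro prod_ge_1) auto
  then show "gnorm (z S) \<le> (\<Prod>S\<in>I. gnorm (z S))" if "S \<in> I"
    using assms(1) that by (intro dvd_imp_le dvd_prodI) linarith+
qed

lemma finite_tuples:
  assumes "finite I" shows "finite (tuples I n)"
proof (rule finite_subset)
  show "tuples I n \<subseteq> I \<rightarrow>\<^sub>E {z. gnorm z \<le> n}"
  proof
    fix z assume "z \<in> tuples I n"
    then have z: "z \<in> I \<rightarrow>\<^sub>E quad" "(\<Prod>S\<in>I. gnorm (z S)) = n" by (auto simp: tuples_def)
    then show "z \<in> I \<rightarrow>\<^sub>E {z. gnorm z \<le> n}"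
      using prod_gnorm_quad(2)[OF assms z(1)] by (auto simp: PiE_iff)
  qed
qed (simp add: assms finite_PiE finite_gnorm_le)

lemma normalize_in_quad: "z \<noteq> 0 \<Longrightarrow> normalize z \<in> quad"
  by (simp add: quad_def)

definition twist_tuple :: "nat \<Rightarrow> (nat set \<Rightarrow> gint) \<Rightarrow> nat \<Rightarrow> gint"
  where "twist_tuple k z = (\<lambda>j\<in>{..<k}. normalize (twist_prod (Pow {1..<k}) z j))"

text \<open>By \<open>twist_prod_surj\<close>, \<open>twist_tuple\<close> maps the tuples of factors
  onto all \<open>k\<close>-tuples of points of norm \<open>n\<close>. Normalizing the factors
  changes the entries by units only.\<close>

lemma sphere_quad_power_le:
  assumes "k \<ge> 1" "n > 0"
  shows "card (sphere_quad n) ^ k \<le> card (tuples (Pow {1..<k}) n)"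
proof -
  let ?I = "Pow {1..<k}"
  have "{..<k} \<rightarrow>\<^sub>E sphere_quad n \<subseteq> twist_tuple k ` tuples ?I n"
  proof
    fix w assume w: "w \<in> {..<k} \<rightarrow>\<^sub>E sphere_quad n"
    have wj: "gnorm (w j) = n" "normalize (w j) = w j" if "j < k" for j
      using PiE_mem[OF w, of j] that by (auto simp: sphere_quad_def quad_def)
    obtain z where z: "\<And>S. S \<in> ?I \<Longrightarrow> z S \<noteq> 0"
      "\<And>j. j < k \<Longrightarrow> normalize (twist_prod ?I z j) = normalize (w j)"
      using twist_prod_surj[of k n w] wj(1) assms by blast
    define z' where "z' = (\<lambda>S\<in>?I. normalize (z S))"
    have z': "normalize (twist_prod ?I z' j) = w j" if "j < k" for j
    proof -
      have "normalize (twist_prod ?I z' j) = normalize (twist_prod ?I z j)"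
        unfolding twist_prod_def
      proof (rule normalize_prod_cong)
        fix S assume "S \<in> ?I"
        then have "normalize (z' S) = normalize (z S)" by (simp add: z'_def)
        then show "normalize (cnj_if (j \<in> S) (z' S)) = normalize (cnj_if (j \<in> S) (z S))"
          using normalize_gcnj_cong[of "z' S" "z S"] by (simp add: cnj_if_def)
      qed
      then show ?thesis using z(2) wj(2) that by simp
    qed
    \<comment> \<open>All entries have the same norm as the product of the factors; index
      \<open>0\<close> is available since \<open>k \<ge> 1\<close>.\<close>
    have "gnorm (normalize (twist_prod ?I z' 0)) = n" using z'[of 0] wj(1)[of 0] assms(1) by simp
    then have "(\<Prod>S\<in>?I. gnorm (z' S)) = n" by (simp add: gnorm_twist_prod)
    then have "z' \<in> tuples ?I n"
      using z(1) by (simp add: tuples_def z'_def normalize_in_quad)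
    moreover have "twist_tuple k z' = w"
    proof
      fix j show "twist_tuple k z' j = w j"
        using z'[of j] PiE_arb[OF w, of j] by (cases "j < k") (auto simp: twist_tuple_def)
    qed
    ultimately show "w \<in> twist_tuple k ` tuples ?I n" by blast
  qed
  then have "card ({..<k} \<rightarrow>\<^sub>E sphere_quad n) \<le> card (tuples ?I n)"
    by (meson finite_tuples surj_card_le finite_Pow_iff finite_atLeastLessThan)
  then show ?thesis by (simp add: card_PiE)
qed

section \<open>Good tuples and injectivity of the parametrization\<close>

text \<open>A pattern \<open>(S, T, m)\<close> describes a way in which the norms of a tuple can fail to be
  odd, squarefree and pairwise coprime: a common factor of the entries \<open>S\<close> and \<open>T\<close>
  (\<open>m = 0\<close>), a factor of one whose conjugate divides the other (\<open>m = 1\<close>), or a factor of the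
  entry \<open>S\<close> associated to its own conjugate (\<open>m = 2\<close>; here \<open>T\<close> plays no role). For \<open>S = T\<close> the
  two factors are multiplied.\<close>

definition factor_pattern :: "'b \<times> 'b \<times> nat \<Rightarrow> gint \<Rightarrow> 'b \<Rightarrow> gint"
  where "factor_pattern = (\<lambda>(S, T, m) c U. (if U = S then c else 1) *
    (if U = T then (if m = 0 then c else if m = 1 then gcnj c else 1) else 1))"

lemma factor_pattern_simps:
  "factor_pattern (S, T, 0) c U = (if U = S then c else 1) * (if U = T then c else 1)"
  "factor_pattern (S, T, 1) c U = (if U = S then c else 1) * (if U = T then gcnj c else 1)"
  "factor_pattern (S, T, 2) c U = (if U = S then c else 1)"
  by (simp_all add: factor_pattern_def)

definition patterns :: "'b set \<Rightarrow> ('b \<times> 'b \<times> nat) set"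
  where "patterns I = I \<times> I \<times> {0, 1, 2}"

text \<open>As \<open>c\<close> and \<open>gcnj c\<close> have equal norm,
  \<open>c dvd gcnj c\<close> means that they are associated. The condition is closed under
  products, so one parameter per pattern can absorb all primes removed through it.\<close>

definition admissible :: "'b \<times> 'b \<times> nat \<Rightarrow> gint set"
  where "admissible = (\<lambda>(S, T, m). {c. c \<noteq> 0 \<and> (m = 2 \<longrightarrow> c dvd gcnj c)})"

definition good :: "'b set \<Rightarrow> ('b \<Rightarrow> gint) \<Rightarrow> bool"
  where "good I y \<longleftrightarrow> (\<forall>p d. prime_elem p \<longrightarrow> d \<in> patterns I \<longrightarrow> p \<in> admissible d \<longrightarrow>
    \<not> (\<forall>U\<in>I. factor_pattern d p U dvd y U))"

text \<open>Each conclusion comes from one pattern: \<open>(S, S, 2)\<close>,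
  \<open>(S, S, 0)\<close>, \<open>(S, S, 1)\<close>, and for distinct entries
  \<open>(S, T, 0)\<close> or \<open>(S, T, 1)\<close>.\<close>

lemma goodD:
  assumes "good I y" "prime_elem p" "S \<in> I" "p dvd y S"
  shows "\<not> p dvd gcnj p"
    and "\<not> p * p dvd y S" "\<not> p * gcnj p dvd y S"
    and "T \<in> I \<Longrightarrow> cnj_if b p dvd y T \<Longrightarrow> T = S"
proof -
  have *: "\<not> (\<forall>U\<in>I. factor_pattern d p U dvd y U)" if "d \<in> patterns I" "p \<in> admissible d" for d
    using assms(1,2) that unfolding good_def by blast
  have p0: "p \<noteq> 0" using assms(2) by auto
  show "\<not> p dvd gcnj p"
    using *[of "(S, S, 2)"] assms(3,4) p0
    by (auto simp: patterns_def admissible_def factor_pattern_simps split: if_splits)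
  show "\<not> p * p dvd y S"
    using *[of "(S, S, 0)"] assms(3,4) p0
    by (auto simp: patterns_def admissible_def factor_pattern_simps split: if_splits)
  show "\<not> p * gcnj p dvd y S"
    using *[of "(S, S, 1)"] assms(3,4) p0
    by (auto simp: patterns_def admissible_def factor_pattern_simps simp del: One_nat_def split: if_splits)
  show "T = S" if T: "T \<in> I" "cnj_if b p dvd y T"
  proof (rule ccontr)
    assume "T \<noteq> S"
    then have "\<forall>U\<in>I. factor_pattern (S, T, if b then 1 else 0) p U dvd y U"
      using assms(4) T by (auto simp: factor_pattern_def cnj_if_def)
    then show False using *[of "(S, T, if b then 1 else 0)"] assms(3) T p0
      by (auto simp: patterns_def admissible_def)
  qed
qed

text \<open>The last hypothesis makes \<open>a\<close> squarefree, so a prime occurs in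
  \<open>a\<close> at most once, and then at least once in \<open>b\<close>.\<close>

lemma dvd_of_prime_dvd:
  fixes a b :: "'a :: factorial_semiring"
  assumes "a \<noteq> 0" "b \<noteq> 0"
    and "\<And>p. prime_elem p \<Longrightarrow> p dvd a \<Longrightarrow> p dvd b"
    and "\<And>p. prime_elem p \<Longrightarrow> \<not> p * p dvd a"
  shows "a dvd b"
proof (rule multiplicity_le_imp_dvd)
  fix p :: 'a assume "prime p"
  then have p: "prime_elem p" by simp
  have "multiplicity p a < 2"
    using assms(1,4) p by (intro multiplicity_lessI) (auto simp: power2_eq_square)
  moreover have "multiplicity p b > 0" if "multiplicity p a > 0"
    using that assms(1-3) p prime_multiplicity_gt_zero_iff by blast
  ultimately show "multiplicity p a \<le> multiplicity p b" by linarith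
qed fact+

text \<open>A prime \<open>p\<close> of \<open>y S\<close> occurs in entry \<open>j\<close>,
  conjugated when \<open>j \<in> S\<close>. Entry \<open>0\<close> yields \<open>T\<close> with
  \<open>p dvd y' T\<close>. If \<open>T\<close> differs from \<open>S\<close>, some
  \<open>j\<close> lies in exactly one of them; by goodness the match in entry \<open>j\<close> also
  comes from \<open>T\<close>, which forces \<open>gcnj p dvd y' T\<close>. Since \<open>p\<close>
  and \<open>gcnj p\<close> are not associated, \<open>p * gcnj p\<close> divides
  \<open>y' T\<close>, which goodness forbids.\<close>

lemma good_dvd_of_twist_prod_eq:
  assumes "good I y" "good I y'" "I = Pow {1..<k}" "k \<ge> 1"
    and nz: "\<And>S. S \<in> I \<Longrightarrow> y S \<noteq> 0" "\<And>S. S \<in> I \<Longrightarrow> y' S \<noteq> 0"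
    and eq: "\<And>j. j < k \<Longrightarrow> normalize (twist_prod I y j) = normalize (twist_prod I y' j)"
    and S: "S \<in> I"
  shows "y S dvd y' S"
proof (rule dvd_of_prime_dvd)
  have I: "finite I" using assms(3) by simp
  show "\<not> p * p dvd y S" if "prime_elem p" for p
    using goodD(2)[OF assms(1) that S] by (meson dvd_mult_left)
  fix p assume p: "prime_elem p" "p dvd y S"
  have transfer: "\<exists>U\<in>I. cnj_if (j \<in> S) p dvd cnj_if (j \<in> U) (y' U)" if "j < k" for j
  proof -
    have "cnj_if (j \<in> S) p dvd cnj_if (j \<in> S) (y S)" using p(2) by simp
    also have "\<dots> dvd twist_prod I y j"
      unfolding twist_prod_def using I S by (intro dvd_prodI)
    also have "\<dots> dvd twist_prod I y' j"
      using eq[OF that] by (simp add: associated_iff_dvd)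
    finally have "cnj_if (j \<in> S) p dvd (\<Prod>U\<in>I. cnj_if (j \<in> U) (y' U))"
      by (simp only: twist_prod_def)
    moreover have "prime_elem (cnj_if (j \<in> S) p)" using p(1) by simp
    ultimately show ?thesis using prime_elem_dvd_prodE[OF I] by meson
  qed
  \<comment> \<open>Nothing is conjugated in entry \<open>0\<close>, so \<open>p\<close> itself
    divides a factor there.\<close>
  have "0 \<notin> U" if "U \<in> I" for U using that assms(3) by auto
  then obtain T where T: "T \<in> I" "p dvd y' T"
    using transfer[of 0] assms(4) S by (auto simp: cnj_if_def)
  show "p dvd y' S"
  proof (cases "S = T")
    case False
    then obtain j where j: "j \<in> S \<longleftrightarrow> j \<notin> T" by blast
    moreover have "j < k" using j S T(1) assms(3) by auto
    ultimately obtain U where U: "U \<in> I" "cnj_if (j \<in> S) p dvd cnj_if (j \<in> U) (y' U)"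
      using transfer by blast
    then have "cnj_if (j \<in> U) (cnj_if (j \<in> S) p) dvd cnj_if (j \<in> U) (cnj_if (j \<in> U) (y' U))"
      by (simp only: cnj_if_dvd_iff)
    then have *: "cnj_if ((j \<in> U) \<noteq> (j \<in> S)) p dvd y' U" by (simp add: cnj_if_def split: if_splits)
    then have "U = T" using goodD(4)[OF assms(2) p(1) T] U(1) by blast
    then have "gcnj p dvd y' T" using * j by (auto simp: cnj_if_def)
    then obtain m where m: "y' T = gcnj p * m" by (elim dvdE)
    then have "p dvd m"
      using T(2) p(1) goodD(1)[OF assms(2) p(1) T] by (auto simp: prime_elem_dvd_mult_iff)
    then have "p * gcnj p dvd y' T" unfolding m by (metis dvd_refl mult.commute mult_dvd_mono)
    then show ?thesis using goodD(3)[OF assms(2) p(1) T] by blast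
  qed (use T in simp)
qed (use nz S in auto)

text \<open>On good tuples \<open>twist_tuple\<close> is injective: equal images give divisibility
  in both directions for every entry, and associated elements of \<open>quad\<close>
  coincide.\<close>

lemma card_good_tuples_le:
  assumes "k \<ge> 1"
  shows "card {y \<in> tuples (Pow {1..<k}) n. good (Pow {1..<k}) y} \<le> card (sphere_quad n) ^ k"
proof -
  define I where "I = Pow {1..<k}"
  have I: "finite I" by (simp add: I_def)
  have "inj_on (twist_tuple k) {y \<in> tuples I n. good I y}"
  proof (rule inj_onI)
    fix y y' assume y: "y \<in> {y \<in> tuples I n. good I y}" and y': "y' \<in> {y \<in> tuples I n. good I y}"
      and "twist_tuple k y = twist_tuple k y'"
    then have eq: "normalize (twist_prod I y j) = normalize (twist_prod I y' j)" if "j < k" for j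
      using that by (auto simp: twist_tuple_def I_def dest!: fun_cong[of _ _ j])
    have q: "y S \<noteq> 0" "normalize (y S) = y S" "y' S \<noteq> 0" "normalize (y' S) = y' S" if "S \<in> I" for S
      using y y' that PiE_mem[of y I "\<lambda>_. quad" S] PiE_mem[of y' I "\<lambda>_. quad" S]
      by (simp_all add: tuples_def quad_def)
    show "y = y'"
    proof (rule PiE_ext[of _ I "\<lambda>_. quad"])
      fix S assume "S \<in> I"
      then have "y S dvd y' S" "y' S dvd y S"
        using good_dvd_of_twist_prod_eq[OF _ _ I_def assms, of y y' S]
          good_dvd_of_twist_prod_eq[OF _ _ I_def assms, of y' y S] y y' q eq by auto
      then show "y S = y' S" using q[OF \<open>S \<in> I\<close>] by (metis associatedI)
    qed (use y y' in \<open>simp_all add: tuples_def\<close>)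
  qed
  moreover have "twist_tuple k ` {y \<in> tuples I n. good I y} \<subseteq> {..<k} \<rightarrow>\<^sub>E sphere_quad n"
  proof (intro image_subsetI)
    fix y assume y: "y \<in> {y \<in> tuples I n. good I y}"
    then have n: "gnorm (twist_prod I y j) = n" for j by (simp add: gnorm_twist_prod tuples_def)
    have "n \<ge> 1" using y prod_gnorm_quad(1)[OF I, of y] by (auto simp: tuples_def)
    then have "twist_prod I y j \<noteq> 0" for j using n[of j] by (metis gnorm_0 not_one_le_zero)
    then show "twist_tuple k y \<in> {..<k} \<rightarrow>\<^sub>E sphere_quad n"
      using n by (auto simp: twist_tuple_def sphere_quad_def normalize_in_quad
          simp del: One_nat_def simp flip: I_def)
  qed
  ultimately have "card {y \<in> tuples I n. good I y} \<le> card ({..<k} \<rightarrow>\<^sub>E sphere_quad n)"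
    by (intro card_inj_on_le[of "twist_tuple k"]) (simp_all add: finite_PiE)
  then show ?thesis by (simp add: card_PiE I_def)
qed

section \<open>Good tuples form a positive proportion\<close>

lemma factor_pattern_mult:
  "factor_pattern d (x * y) U = factor_pattern d x U * factor_pattern d y U"
  by (cases d) (simp add: factor_pattern_def)

lemma factor_pattern_1 [simp]: "factor_pattern d 1 U = 1"
  by (cases d) (simp add: factor_pattern_def)

lemma factor_pattern_eq_0_iff: "c \<noteq> 0 \<Longrightarrow> factor_pattern d c U \<noteq> 0"
  by (cases d) (simp add: factor_pattern_def)

lemma admissible_mult: "c \<in> admissible d \<Longrightarrow> c' \<in> admissible d \<Longrightarrow> c * c' \<in> admissible d"
  by (cases d) (auto simp: admissible_def mult_dvd_mono)

lemma one_admissible: "1 \<in> admissible d"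
  by (cases d) (auto simp: admissible_def)

lemma admissible_nonzero: "c \<in> admissible d \<Longrightarrow> c \<noteq> 0"
  by (cases d) (auto simp: admissible_def)

lemma normalize_admissible:
  assumes "c \<in> admissible d" shows "normalize c \<in> admissible d"
proof (cases d)
  case (fields S T m)
  have "normalize (gcnj (normalize c)) = normalize (gcnj c)" by (rule normalize_gcnj_cong) simp
  then have "c dvd gcnj c \<Longrightarrow> normalize c dvd gcnj (normalize c)"
    by (metis dvd_normalize_iff normalize_dvd_iff)
  then show ?thesis using assms fields by (auto simp: admissible_def)
qed

lemma normalize_factor_pattern:
  "normalize (factor_pattern d (normalize c) U) = normalize (factor_pattern d c U)"
proof (cases d)
  case (fields S T m)
  have "normalize (gcnj (normalize c)) = normalize (gcnj c)" by (rule normalize_gcnj_cong) simp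
  then show ?thesis unfolding fields factor_pattern_def prod.case
    by (intro normalize_mult_cong) auto
qed

text \<open>The factor by which multiplication with the pattern increases the product of the
  norms.\<close>

definition pattern_norm :: "'b set \<Rightarrow> 'b \<times> 'b \<times> nat \<Rightarrow> gint \<Rightarrow> nat"
  where "pattern_norm I d c = (\<Prod>U\<in>I. gnorm (factor_pattern d c U))"

text \<open>A pattern with \<open>m = 0\<close> or \<open>m = 1\<close> uses \<open>c\<close> or its
  conjugate twice. The resulting squares make the inverse norms summable; for \<open>m = 2\<close>
  summability comes from the scarcity of self-conjugate \<open>c\<close>.\<close>

lemma pattern_norm_eq:
  assumes "finite I" "d \<in> patterns I"
  shows "pattern_norm I d c = (if snd (snd d) = 2 then gnorm c else (gnorm c)\<^sup>2)"
proof -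
  obtain S T m where d: "d = (S, T, m)" "S \<in> I" "T \<in> I" "m = 0 \<or> m = 1 \<or> m = 2"
    using assms(2) by (auto simp: patterns_def)
  define e where "e = (if m = 2 then 1 else gnorm c)"
  have "gnorm (factor_pattern d c U) = (if U = S then gnorm c else 1) * (if U = T then e else 1)"
    for U
    using d(4) by (auto simp: d(1) factor_pattern_def e_def)
  then have "pattern_norm I d c = (\<Prod>U\<in>I. if U = S then gnorm c else 1) * (\<Prod>U\<in>I. if U = T then e else 1)"
    by (simp add: pattern_norm_def prod.distrib)
  also have "\<dots> = gnorm c * e" using assms(1) d by (simp add: prod.delta)
  finally show ?thesis by (simp add: e_def d(1) power2_eq_square)
qed

text \<open>As long as some prime violates goodness, it is divided out along its pattern
  \<open>d\<close> and multiplied into \<open>\<alpha> d\<close>. The product of the norms drops at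
  each step, so this ends.\<close>

lemma good_decomposition:
  assumes "finite I" "\<And>S. S \<in> I \<Longrightarrow> z S \<noteq> 0"
  shows "\<exists>y \<alpha>. good I y \<and> (\<forall>d\<in>patterns I. \<alpha> d \<in> admissible d) \<and>
    (\<forall>S\<in>I. z S = y S * (\<Prod>d\<in>patterns I. factor_pattern d (\<alpha> d) S))"
  using assms(2)
proof (induction "\<Prod>S\<in>I. gnorm (z S)" arbitrary: z rule: less_induct)
  case less
  show ?case
  proof (cases "good I z")
    case True
    then show ?thesis by (intro exI[of _ z] exI[of _ "\<lambda>_. 1"]) (simp add: one_admissible)
  next
    case False
    then obtain p d where p: "prime_elem p" "d \<in> patterns I" "p \<in> admissible d"
      "\<forall>U\<in>I. factor_pattern d p U dvd z U"
      unfolding good_def by blast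
    have fin: "finite (patterns I)" using assms(1) by (simp add: patterns_def)
    have "\<exists>z'. \<forall>U\<in>I. z U = factor_pattern d p U * z' U"
      using p(4) by (intro bchoice) (auto elim!: dvdE)
    then obtain z' where z': "\<And>U. U \<in> I \<Longrightarrow> z U = factor_pattern d p U * z' U" by blast
    have z'0: "z' U \<noteq> 0" if "U \<in> I" for U using less.prems[OF that] z'[OF that] by auto
    have "gnorm p \<ge> 2"
    proof -
      have "gnorm p \<noteq> 0" "gnorm p \<noteq> 1"
        using p(1) prime_elem_not_unit[of p] gint_is_unit_iff[of p] by auto
      then show ?thesis by linarith
    qed
    then have "pattern_norm I d p \<ge> 2"
      using self_le_power[of "gnorm p" 2] by (auto simp: pattern_norm_eq[OF assms(1) p(2)])
    moreover have "(\<Prod>U\<in>I. gnorm (z' U)) > 0" using z'0 by (intro prod_pos) auto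
    moreover have "(\<Prod>U\<in>I. gnorm (z U)) = pattern_norm I d p * (\<Prod>U\<in>I. gnorm (z' U))"
      unfolding pattern_norm_def prod.distrib[symmetric] using z' by (intro prod.cong) auto
    ultimately have "(\<Prod>U\<in>I. gnorm (z' U)) < (\<Prod>U\<in>I. gnorm (z U))" by simp
    from less.hyps[OF this z'0] obtain y \<alpha> where y: "good I y"
      "\<forall>d\<in>patterns I. \<alpha> d \<in> admissible d"
      "\<forall>S\<in>I. z' S = y S * (\<Prod>d\<in>patterns I. factor_pattern d (\<alpha> d) S)"
      by blast
    have "(\<Prod>e\<in>patterns I. factor_pattern e ((\<alpha>(d := \<alpha> d * p)) e) S) =
        factor_pattern d p S * (\<Prod>e\<in>patterns I. factor_pattern e (\<alpha> e) S)" for S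
    proof -
      have "(\<Prod>e\<in>patterns I. factor_pattern e ((\<alpha>(d := \<alpha> d * p)) e) S) =
        (\<Prod>e\<in>patterns I. (if e = d then factor_pattern d p S else 1) * factor_pattern e (\<alpha> e) S)"
        by (intro prod.cong) (auto simp: factor_pattern_mult)
      then show ?thesis using fin p(2) by (simp add: prod.distrib prod.delta)
    qed
    then have "\<forall>S\<in>I. z S = y S * (\<Prod>e\<in>patterns I. factor_pattern e ((\<alpha>(d := \<alpha> d * p)) e) S)"
      using z' y(3) by (simp add: mult_ac)
    moreover have "\<forall>e\<in>patterns I. (\<alpha>(d := \<alpha> d * p)) e \<in> admissible e"
      using y(2) p(2,3) by (auto simp: admissible_mult)
    ultimately show ?thesis using y(1) by blast
  qed
qed

lemma good_normalize:
  assumes "good I y" "\<And>S. S \<in> I \<Longrightarrow> normalize (y' S) = normalize (y S)"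
  shows "good I y'"
proof -
  have "a dvd y' S \<longleftrightarrow> a dvd y S" if "S \<in> I" for a S
    using assms(2)[OF that] by (metis dvd_normalize_iff)
  then show ?thesis using assms(1) unfolding good_def by simp
qed

definition tuples_le :: "'b set \<Rightarrow> real \<Rightarrow> ('b \<Rightarrow> gint) set"
  where "tuples_le I x = {z \<in> I \<rightarrow>\<^sub>E quad. real (\<Prod>S\<in>I. gnorm (z S)) \<le> x}"

definition weight :: "'b set \<Rightarrow> ('b \<times> 'b \<times> nat \<Rightarrow> gint) \<Rightarrow> nat"
  where "weight I \<alpha> = (\<Prod>d\<in>patterns I. pattern_norm I d (\<alpha> d))"

text \<open>Restricting the parameters to \<open>quad\<close> counts each of them only once up to
  units.\<close>

definition pattern_tuples :: "'b set \<Rightarrow> ('b \<times> 'b \<times> nat \<Rightarrow> gint) set"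
  where "pattern_tuples I = (\<Pi>\<^sub>E d\<in>patterns I. admissible d \<inter> quad)"

lemma pattern_norm_pos: "c \<noteq> 0 \<Longrightarrow> pattern_norm I d c > 0"
  unfolding pattern_norm_def by (intro prod_pos) (auto simp: factor_pattern_eq_0_iff)

lemma weight_pos:
  assumes "\<alpha> \<in> pattern_tuples I" shows "weight I \<alpha> > 0"
  unfolding weight_def
proof (intro prod_pos ballI pattern_norm_pos)
  fix d assume "d \<in> patterns I"
  then show "\<alpha> d \<noteq> 0"
    using assms PiE_mem[of \<alpha> "patterns I" _ d] admissible_nonzero
    unfolding pattern_tuples_def by blast
qed

lemma finite_tuples_le:
  assumes "finite I" shows "finite (tuples_le I x)"
proof (rule finite_subset)
  show "tuples_le I x \<subseteq> I \<rightarrow>\<^sub>E {z. gnorm z \<le> nat \<lfloor>x\<rfloor>}"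
  proof
    fix z assume "z \<in> tuples_le I x"
    then have z: "z \<in> I \<rightarrow>\<^sub>E quad" "(\<Prod>S\<in>I. gnorm (z S)) \<le> nat \<lfloor>x\<rfloor>"
      by (auto simp: tuples_le_def le_nat_iff le_floor_iff simp del: of_nat_prod)
    then show "z \<in> I \<rightarrow>\<^sub>E {z. gnorm z \<le> nat \<lfloor>x\<rfloor>}"
      using prod_gnorm_quad(2)[OF assms z(1)] by (force simp: PiE_iff)
  qed
qed (simp add: assms finite_PiE finite_gnorm_le)

text \<open>Every tuple \<open>z\<close> is assigned a normalized decomposition
  \<open>(\<alpha>, y)\<close>, from which \<open>recon\<close> recovers \<open>z\<close>; the
  product of the norms of \<open>y\<close> is that of \<open>z\<close> divided by the weight of
  \<open>\<alpha>\<close>. The set \<open>P\<close> of the parameters chosen is finite because there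
  are finitely many \<open>z\<close>.\<close>

lemma card_tuples_le_decomposition:
  assumes "finite I"
  obtains P where "finite P" "P \<subseteq> pattern_tuples I"
    "card (tuples_le I x) \<le> (\<Sum>\<alpha>\<in>P. card {y \<in> tuples_le I (x / real (weight I \<alpha>)). good I y})"
proof -
  define G where "G \<alpha> = {y \<in> tuples_le I (x / real (weight I \<alpha>)). good I y}" for \<alpha>
  define recon where "recon = (\<lambda>(\<alpha>, y). \<lambda>S\<in>I.
    normalize (y S * (\<Prod>d\<in>patterns I. factor_pattern d (\<alpha> d) S)))"
  have "\<exists>\<alpha> y. \<alpha> \<in> pattern_tuples I \<and> y \<in> G \<alpha> \<and> z = recon (\<alpha>, y)"
    if z: "z \<in> tuples_le I x" for z
  proof -
    have zS: "z S \<noteq> 0" "normalize (z S) = z S" if "S \<in> I" for S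
      using z that PiE_mem[of z I "\<lambda>_. quad" S] by (auto simp: tuples_le_def quad_def)
    obtain y \<alpha> where y: "good I y" "\<And>d. d \<in> patterns I \<Longrightarrow> \<alpha> d \<in> admissible d"
      "\<And>S. S \<in> I \<Longrightarrow> z S = y S * (\<Prod>d\<in>patterns I. factor_pattern d (\<alpha> d) S)"
      using good_decomposition[of I z] assms zS(1) by blast
    define y' where "y' = (\<lambda>S\<in>I. normalize (y S))"
    define \<alpha>' where "\<alpha>' = (\<lambda>d\<in>patterns I. normalize (\<alpha> d))"
    have yS: "y S \<noteq> 0" if "S \<in> I" for S using zS(1)[OF that] y(3)[OF that] by auto
    have "normalize (\<alpha> d) \<in> admissible d \<inter> quad" if "d \<in> patterns I" for d
      using y(2)[OF that] by (simp add: normalize_admissible admissible_nonzero normalize_in_quad)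
    then have \<alpha>': "\<alpha>' \<in> pattern_tuples I"
      unfolding \<alpha>'_def pattern_tuples_def by (simp only: restrict_PiE_iff) metis
    have assoc: "normalize (y' S * (\<Prod>d\<in>patterns I. factor_pattern d (\<alpha>' d) S)) = z S"
      if S: "S \<in> I" for S
    proof -
      have "normalize (y' S * (\<Prod>d\<in>patterns I. factor_pattern d (\<alpha>' d) S)) =
          normalize (y S * (\<Prod>d\<in>patterns I. factor_pattern d (\<alpha> d) S))"
        using S by (intro normalize_mult_cong normalize_prod_cong)
          (auto simp: y'_def \<alpha>'_def normalize_factor_pattern)
      also have "\<dots> = z S" using y(3) zS(2) S by metis
      finally show ?thesis .
    qed
    have "recon (\<alpha>', y') = z"
    proof
      fix S show "recon (\<alpha>', y') S = z S"
        using assoc z PiE_arb[of z I "\<lambda>_. quad" S] by (auto simp: recon_def tuples_le_def)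
    qed
    moreover have "y' \<in> G \<alpha>'"
    proof -
      have "gnorm (z S) = gnorm (y' S) * (\<Prod>d\<in>patterns I. gnorm (factor_pattern d (\<alpha>' d) S))"
        if "S \<in> I" for S
        by (simp add: gnorm_prod flip: assoc[OF that])
      then have "(\<Prod>S\<in>I. gnorm (z S)) = (\<Prod>S\<in>I. gnorm (y' S)) *
          (\<Prod>S\<in>I. \<Prod>d\<in>patterns I. gnorm (factor_pattern d (\<alpha>' d) S))"
        by (simp add: prod.distrib)
      also have "(\<Prod>S\<in>I. \<Prod>d\<in>patterns I. gnorm (factor_pattern d (\<alpha>' d) S)) = weight I \<alpha>'"
        unfolding weight_def pattern_norm_def by (rule prod.swap)
      finally have "real (\<Prod>S\<in>I. gnorm (y' S)) * real (weight I \<alpha>') \<le> x"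
        using z by (simp add: tuples_le_def flip: of_nat_mult of_nat_prod)
      then have "real (\<Prod>S\<in>I. gnorm (y' S)) \<le> x / real (weight I \<alpha>')"
        using weight_pos[OF \<alpha>'] by (simp add: field_simps del: of_nat_prod)
      moreover have "y' \<in> I \<rightarrow>\<^sub>E quad" using yS by (simp add: y'_def normalize_in_quad)
      moreover have "good I y'" by (rule good_normalize[OF y(1)]) (simp add: y'_def)
      ultimately show ?thesis by (simp add: G_def tuples_le_def)
    qed
    ultimately show ?thesis using \<alpha>' by blast
  qed
  then have "\<forall>z\<in>tuples_le I x. \<exists>ay. fst ay \<in> pattern_tuples I \<and> snd ay \<in> G (fst ay) \<and> z = recon ay"
    by fastforce
  then obtain f where f: "\<And>z. z \<in> tuples_le I x \<Longrightarrow>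
    fst (f z) \<in> pattern_tuples I \<and> snd (f z) \<in> G (fst (f z)) \<and> z = recon (f z)"
    by metis
  define P where "P = fst ` f ` tuples_le I x"
  have finP: "finite P" by (simp add: P_def finite_tuples_le assms)
  have finG: "finite (G \<alpha>)" for \<alpha>
    by (rule finite_subset[OF _ finite_tuples_le[OF assms]]) (auto simp: G_def)
  have "tuples_le I x \<subseteq> recon ` Sigma P G"
  proof
    fix z assume z: "z \<in> tuples_le I x"
    note fz = f[OF z]
    have "fst (f z) \<in> P" using z by (simp add: P_def)
    then have "f z \<in> Sigma P G"
      using fz by (metis SigmaI prod.collapse)
    then show "z \<in> recon ` Sigma P G"
      by (rule image_eqI[where f = recon and x = "f z", rotated])
        (rule conjunct2[OF conjunct2[OF fz]])
  qed
  then have "card (tuples_le I x) \<le> card (Sigma P G)"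
    using finP finG by (intro surj_card_le) auto
  also have "\<dots> = (\<Sum>\<alpha>\<in>P. card (G \<alpha>))" using finP finG by simp
  finally show thesis using that[of P] finP f by (auto simp: P_def G_def)
qed

section \<open>Summability of the inverse weights\<close>

lemma sum_inverse_squares_le:
  fixes A :: "nat set"
  assumes "finite A" "0 \<notin> A"
  shows "(\<Sum>a\<in>A. 1 / (real a)\<^sup>2) \<le> 2"
proof -
  \<comment> \<open>The term \<open>1 / real M\<close> makes the induction close by
    telescoping.\<close>
  have *: "(\<Sum>a=1..M. 1 / (real a)\<^sup>2) \<le> 2 - 1 / real M" if "M \<ge> 1" for M
    using that
  proof (induction M rule: nat_induct_at_least)
    case (Suc n)
    have "1 / (real (Suc n))\<^sup>2 \<le> 1 / (real n * real (Suc n))"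
      using Suc.hyps by (intro divide_left_mono) (auto simp: power2_eq_square)
    also have "\<dots> = 1 / real n - 1 / real (Suc n)" using Suc.hyps by (simp add: field_simps)
    finally show ?case using Suc.IH by simp
  qed simp
  have "A \<subseteq> {1..Suc (Max (insert 0 A))}"
  proof
    fix a assume "a \<in> A"
    then have "a \<noteq> 0" using assms(2) by metis
    moreover have "a \<le> Max (insert 0 A)" using assms(1) \<open>a \<in> A\<close> by simp
    ultimately show "a \<in> {1..Suc (Max (insert 0 A))}" by simp
  qed
  then have "(\<Sum>a\<in>A. 1 / (real a)\<^sup>2) \<le> (\<Sum>a=1..Suc (Max (insert 0 A)). 1 / (real a)\<^sup>2)"
    by (intro sum_mono2) auto
  also have "\<dots> \<le> 2" by (rule order.trans[OF *]) auto
  finally show ?thesis .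
qed

definition lattice_point :: "nat \<times> nat \<Rightarrow> gint"
  where "lattice_point = (\<lambda>(a, b). GInt (int a) (int b))"

lemma inj_lattice_point: "inj_on lattice_point A"
  by (auto simp: inj_on_def lattice_point_def)

lemma lattice_point_in_quad: "lattice_point (a, b) \<in> quad \<longleftrightarrow> a \<ge> 1"
proof -
  have "lattice_point (a, b) \<noteq> 0" if "a \<ge> 1" using that by (simp add: lattice_point_def gint_eq_iff)
  then show ?thesis
    using normalize_gint_eq_iff[of "lattice_point (a, b)"]
    by (auto simp: quad_def lattice_point_def gint_eq_iff)
qed

lemma gnorm_lattice_point: "gnorm (lattice_point (a, b)) = a\<^sup>2 + b\<^sup>2"
  by (simp add: gnorm_def lattice_point_def nat_add_distrib nat_power_eq)

lemma quad_eq_lattice_point: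
  assumes "z \<in> quad"
  obtains a b where "a \<ge> 1" "z = lattice_point (a, b)"
proof -
  have "gre z > 0" "gim z \<ge> 0" using assms normalize_gint_eq_iff[of z] by (auto simp: quad_def)
  then show thesis
    by (intro that[of "nat (gre z)" "nat (gim z)"]) (auto simp: lattice_point_def gint_eq_iff)
qed

text \<open>For \<open>a \<ge> 1\<close> the square of \<open>a\<^sup>2 + b\<^sup>2\<close> is at
  least \<open>a\<^sup>2 * (1 + b\<^sup>2)\<close>, which separates the variables. The two sums are
  at most \<open>2\<close> and \<open>1 + 2\<close>.\<close>

lemma sum_inverse_gnorm_squares_le:
  assumes "finite A" "A \<subseteq> quad"
  shows "(\<Sum>c\<in>A. 1 / real ((gnorm c)\<^sup>2)) \<le> 6"
proof -
  define B where "B = lattice_point -` A"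
  have AB: "A = lattice_point ` B"
    using assms(2) quad_eq_lattice_point unfolding B_def by blast
  have B: "finite B" unfolding B_def using assms(1) by (intro finite_vimageI inj_lattice_point)
  have B1: "a \<ge> 1" if "(a, b) \<in> B" for a b
    using that assms(2) lattice_point_in_quad unfolding B_def by blast
  have "(\<Sum>c\<in>A. 1 / real ((gnorm c)\<^sup>2)) = (\<Sum>p\<in>B. 1 / real ((gnorm (lattice_point p))\<^sup>2))"
    unfolding AB by (simp add: sum.reindex inj_lattice_point)
  also have "\<dots> \<le> (\<Sum>(a, b)\<in>B. 1 / (real a)\<^sup>2 * (1 / (1 + (real b)\<^sup>2)))"
  proof (rule sum_mono)
    fix p assume "p \<in> B"
    then obtain a b where p: "p = (a, b)" "a \<ge> 1" using B1 by (cases p) auto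
    have "(real a)\<^sup>2 * (1 + (real b)\<^sup>2) \<le> ((real a)\<^sup>2 + (real b)\<^sup>2) * ((real a)\<^sup>2 + (real b)\<^sup>2)"
      using p(2) by (intro mult_mono) auto
    then have "1 / ((real a)\<^sup>2 + (real b)\<^sup>2)\<^sup>2 \<le> 1 / ((real a)\<^sup>2 * (1 + (real b)\<^sup>2))"
      using p(2) by (intro divide_left_mono) (auto simp: power2_eq_square add_pos_nonneg)
    then show "1 / real ((gnorm (lattice_point p))\<^sup>2) \<le>
      (case p of (a, b) \<Rightarrow> 1 / (real a)\<^sup>2 * (1 / (1 + (real b)\<^sup>2)))"
      by (simp add: p gnorm_lattice_point)
  qed
  \<comment> \<open>The index set is enlarged to a product of projections; \<open>0\<close> is
    inserted so that its term \<open>1\<close> can be split off.\<close>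
  also have "\<dots> \<le> (\<Sum>(a, b)\<in>fst ` B \<times> insert 0 (snd ` B). 1 / (real a)\<^sup>2 * (1 / (1 + (real b)\<^sup>2)))"
    using B by (intro sum_mono2) (force simp: image_iff)+
  also have "\<dots> = (\<Sum>a\<in>fst ` B. 1 / (real a)\<^sup>2) * (\<Sum>b\<in>insert 0 (snd ` B). 1 / (1 + (real b)\<^sup>2))"
    by (simp only: sum_product sum.cartesian_product)
  also have "\<dots> \<le> 2 * 3"
  proof (intro mult_mono)
    show "(\<Sum>a\<in>fst ` B. 1 / (real a)\<^sup>2) \<le> 2"
      using B B1 by (intro sum_inverse_squares_le) force+
    have "(\<Sum>b\<in>insert 0 (snd ` B). 1 / (1 + (real b)\<^sup>2)) =
        1 + (\<Sum>b\<in>snd ` B - {0}. 1 / (1 + (real b)\<^sup>2))"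
      using B by (simp add: sum.insert_remove)
    also have "(\<Sum>b\<in>snd ` B - {0}. 1 / (1 + (real b)\<^sup>2)) \<le> (\<Sum>b\<in>snd ` B - {0}. 1 / (real b)\<^sup>2)"
      by (intro sum_mono divide_left_mono mult_pos_pos) (auto simp: add_pos_nonneg)
    also have "\<dots> \<le> 2" using B by (intro sum_inverse_squares_le) auto
    finally show "(\<Sum>b\<in>insert 0 (snd ` B). 1 / (1 + (real b)\<^sup>2)) \<le> 3" by simp
  qed (auto intro!: sum_nonneg)
  finally show ?thesis by simp
qed

text \<open>The quotient of \<open>gcnj c\<close> by \<open>c\<close> is a unit. In the first
  quadrant only the units \<open>1\<close> and \<open>GInt 0 (- 1)\<close> are possible, giving the
  real axis and the diagonal.\<close>

lemma self_conjugate_cases: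
  assumes "c \<in> quad" "c dvd gcnj c"
  shows "gim c = 0 \<or> gim c = gre c"
proof -
  have pos: "gre c > 0" "gim c \<ge> 0" "c \<noteq> 0"
    using assms(1) normalize_gint_eq_iff[of c] by (auto simp: quad_def)
  obtain u where u: "gcnj c = c * u" using assms(2) by (elim dvdE)
  then have "gnorm c = gnorm c * gnorm u" by (metis gnorm_gcnj gnorm_mult)
  then have "gnorm u = 1" using pos(3) by simp
  then show ?thesis using u pos gnorm_eq_1_cases[of u] by (auto simp: gint_eq_iff)
qed

text \<open>Such \<open>c\<close> lie on two rays, on each of which the real part determines
  \<open>c\<close>. Both contribute at most a sum of inverse squares, hence
  \<open>2\<close>.\<close>

lemma sum_inverse_gnorm_self_conjugate_le:
  assumes "finite A" "A \<subseteq> {c \<in> quad. c dvd gcnj c}"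
  shows "(\<Sum>c\<in>A. 1 / real (gnorm c)) \<le> 4"
proof -
  have pos: "gre c > 0" if "c \<in> A" for c
    using assms(2) that normalize_gint_eq_iff[of c] by (auto simp: quad_def)
  have sub: "(\<Sum>c\<in>B. 1 / real (gnorm c)) \<le> 2"
    if B: "B \<subseteq> A" "inj_on gre B" for B
  proof -
    have inj: "inj_on (\<lambda>c. nat (gre c)) B"
    proof (rule inj_onI)
      fix x y assume xy: "x \<in> B" "y \<in> B" "nat (gre x) = nat (gre y)"
      then have "gre x = gre y" using pos[of x] pos[of y] B(1) by auto
      then show "x = y" using B(2) xy by (meson inj_onD)
    qed
    have "(\<Sum>c\<in>B. 1 / real (gnorm c)) \<le> (\<Sum>c\<in>B. 1 / (real (nat (gre c)))\<^sup>2)"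
    proof (rule sum_mono)
      fix c assume "c \<in> B"
      then have c: "gre c > 0" using pos B by auto
      have "(nat (gre c))\<^sup>2 \<le> gnorm c"
        using c by (simp add: gnorm_def nat_mono flip: nat_power_eq)
      then have "real ((nat (gre c))\<^sup>2) \<le> real (gnorm c)" by (rule of_nat_mono)
      then have "(real (nat (gre c)))\<^sup>2 \<le> real (gnorm c)" by (simp only: of_nat_power)
      moreover have "real (nat (gre c)) > 0" using c by simp
      ultimately show "1 / real (gnorm c) \<le> 1 / (real (nat (gre c)))\<^sup>2"
        by (intro divide_left_mono mult_pos_pos) auto
    qed
    also have "\<dots> = (\<Sum>a\<in>(\<lambda>c. nat (gre c)) ` B. 1 / (real a)\<^sup>2)"
      by (simp add: sum.reindex[OF inj])
    also have "\<dots> \<le> 2"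
      using pos B(1) finite_subset[OF B(1) assms(1)] by (intro sum_inverse_squares_le) force+
    finally show ?thesis .
  qed
  have "A = {c \<in> A. gim c = 0} \<union> {c \<in> A. gim c = gre c}"
    using assms(2) self_conjugate_cases by blast
  then have "(\<Sum>c\<in>A. 1 / real (gnorm c)) =
      (\<Sum>c\<in>{c \<in> A. gim c = 0} \<union> {c \<in> A. gim c = gre c}. 1 / real (gnorm c))" by simp
  also have "\<dots> = (\<Sum>c\<in>{c \<in> A. gim c = 0}. 1 / real (gnorm c)) +
      (\<Sum>c\<in>{c \<in> A. gim c = gre c}. 1 / real (gnorm c))"
    using assms(1) pos by (intro sum.union_disjoint) force+
  also have "\<dots> \<le> 2 + 2"
    by (intro add_mono sub) (auto simp: inj_on_def gint_eq_iff)
  finally show ?thesis by simp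
qed

text \<open>Enlarging \<open>P\<close> to the product of its projections turns the sum into a
  product of one sum per pattern, each at most \<open>6\<close>.\<close>

lemma sum_inverse_weight_le:
  assumes "finite I" "finite P" "P \<subseteq> pattern_tuples I"
  shows "(\<Sum>\<alpha>\<in>P. 1 / real (weight I \<alpha>)) \<le> 6 ^ card (patterns I)"
proof -
  have fin: "finite (patterns I)" using assms(1) by (simp add: patterns_def)
  define Q where "Q = (\<Pi>\<^sub>E d\<in>patterns I. (\<lambda>\<alpha>. \<alpha> d) ` P)"
  have PQ: "P \<subseteq> Q" using assms(3) by (auto simp: Q_def pattern_tuples_def PiE_iff)
  have "finite Q" unfolding Q_def using fin assms(2) by (intro finite_PiE) auto
  then have "(\<Sum>\<alpha>\<in>P. 1 / real (weight I \<alpha>)) \<le> (\<Sum>\<alpha>\<in>Q. 1 / real (weight I \<alpha>))"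
    using PQ by (intro sum_mono2) auto
  also have "\<dots> = (\<Sum>\<alpha>\<in>Q. \<Prod>d\<in>patterns I. 1 / real (pattern_norm I d (\<alpha> d)))"
    by (simp add: weight_def prod_dividef)
  also have "\<dots> = (\<Prod>d\<in>patterns I. \<Sum>c\<in>(\<lambda>\<alpha>. \<alpha> d) ` P. 1 / real (pattern_norm I d c))"
    unfolding Q_def using fin assms(2) by (subst prod_sum_PiE) auto
  also have "\<dots> \<le> (\<Prod>d\<in>patterns I. 6)"
  proof (rule prod_mono, intro conjI)
    fix d assume d: "d \<in> patterns I"
    have sub: "(\<lambda>\<alpha>. \<alpha> d) ` P \<subseteq> admissible d \<inter> quad"
      using assms(3) d by (auto simp: pattern_tuples_def)
    show "(\<Sum>c\<in>(\<lambda>\<alpha>. \<alpha> d) ` P. 1 / real (pattern_norm I d c)) \<le> 6"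
    proof (cases "snd (snd d) = 2")
      case True
      then have "(\<lambda>\<alpha>. \<alpha> d) ` P \<subseteq> {c \<in> quad. c dvd gcnj c}"
        using sub by (cases d) (auto simp: admissible_def)
      from sum_inverse_gnorm_self_conjugate_le[OF _ this] show ?thesis
        using assms(2) True by (simp add: pattern_norm_eq[OF assms(1) d])
    next
      case False
      have "(\<lambda>\<alpha>. \<alpha> d) ` P \<subseteq> quad" using sub by blast
      from sum_inverse_gnorm_squares_le[OF _ this] show ?thesis
        using assms(2) False by (simp add: pattern_norm_eq[OF assms(1) d])
    qed
  qed (auto intro!: sum_nonneg)
  finally show ?thesis by simp
qed

text \<open>A finite \<open>P0\<close> whose sum is within \<open>\<epsilon>\<close> of the supremum
  leaves at most \<open>\<epsilon>\<close> for every finite subset of \<open>U\<close> disjoint from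
  it.\<close>

lemma small_tail:
  fixes w :: "'b \<Rightarrow> real"
  assumes "\<And>P. finite P \<Longrightarrow> P \<subseteq> U \<Longrightarrow> sum w P \<le> B" "\<epsilon> > 0"
  obtains P0 where "finite P0" "\<And>P. finite P \<Longrightarrow> P \<subseteq> U - P0 \<Longrightarrow> sum w P \<le> \<epsilon>"
proof -
  define X where "X = sum w ` {P. finite P \<and> P \<subseteq> U}"
  have bdd: "bdd_above X" unfolding X_def bdd_above_def using assms(1) by blast
  have "X \<noteq> {}" by (auto simp: X_def)
  then obtain P0 where P0: "finite P0" "P0 \<subseteq> U" "sum w P0 > Sup X - \<epsilon>"
    using less_cSupD[of X "Sup X - \<epsilon>"] assms(2) by (auto simp: X_def)
  have "sum w P \<le> \<epsilon>" if P: "finite P" "P \<subseteq> U - P0" for P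
  proof -
    have "sum w (P \<union> P0) \<le> Sup X"
      using P P0 by (intro cSup_upper bdd) (auto simp: X_def)
    moreover have "sum w (P \<union> P0) = sum w P + sum w P0"
      using P P0 by (intro sum.union_disjoint) auto
    ultimately show ?thesis using P0(3) by linarith
  qed
  then show thesis using that P0(1) by blast
qed

section \<open>Counting tuples by norm\<close>

definition ball_quad :: "real \<Rightarrow> gint set"
  where "ball_quad x = {z \<in> quad. real (gnorm z) \<le> x}"

definition inverse_norm_sum :: "real \<Rightarrow> real"
  where "inverse_norm_sum x = (\<Sum>z\<in>ball_quad x. 1 / real (gnorm z))"

lemma finite_ball_quad: "finite (ball_quad x)"
  by (rule finite_subset[OF _ finite_gnorm_le[of "nat \<lfloor>x\<rfloor>"]])
    (auto simp: ball_quad_def le_nat_iff le_floor_iff)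

lemma ball_quad_subset_lattice:
  assumes "x \<ge> 0"
  shows "ball_quad x \<subseteq> lattice_point ` ({1..nat \<lfloor>sqrt x\<rfloor>} \<times> {0..nat \<lfloor>sqrt x\<rfloor>})"
proof
  fix z assume z: "z \<in> ball_quad x"
  then obtain a b where ab: "a \<ge> 1" "z = lattice_point (a, b)"
    using quad_eq_lattice_point unfolding ball_quad_def by blast
  have le: "(real a)\<^sup>2 + (real b)\<^sup>2 \<le> x"
    using z by (simp add: ball_quad_def ab gnorm_lattice_point)
  have "(real a)\<^sup>2 \<le> x" "(real b)\<^sup>2 \<le> x"
    using le zero_le_power2[of "real a"] zero_le_power2[of "real b"] by linarith+
  then have "real a \<le> sqrt x" "real b \<le> sqrt x" by (simp_all add: real_le_rsqrt)
  then have "a \<le> nat \<lfloor>sqrt x\<rfloor>" "b \<le> nat \<lfloor>sqrt x\<rfloor>" by linarith+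
  then show "z \<in> lattice_point ` ({1..nat \<lfloor>sqrt x\<rfloor>} \<times> {0..nat \<lfloor>sqrt x\<rfloor>})" using ab by simp
qed

text \<open>The ball lies in a box of \<open>m * (m + 1)\<close> points with \<open>m\<close> the
  floor of \<open>sqrt x\<close>.\<close>

lemma card_ball_quad_le:
  assumes "x \<ge> 0" shows "real (card (ball_quad x)) \<le> 2 * x"
proof -
  define m where "m = nat \<lfloor>sqrt x\<rfloor>"
  have "card (ball_quad x) \<le> card (lattice_point ` ({1..m} \<times> {0..m}))"
    unfolding m_def by (intro card_mono ball_quad_subset_lattice assms) auto
  also have "\<dots> = m * (m + 1)" by (subst card_image) (simp_all add: inj_lattice_point)
  also have "\<dots> \<le> 2 * m\<^sup>2" by (cases m) (simp_all add: power2_eq_square)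
  finally have "real (card (ball_quad x)) \<le> real (2 * m\<^sup>2)" by (rule of_nat_mono)
  also have "real m \<le> sqrt x" using assms by (simp add: m_def)
  then have "(real m)\<^sup>2 \<le> x" using assms by (metis of_nat_0_le_iff power_mono real_sqrt_pow2)
  then have "real (2 * m\<^sup>2) \<le> 2 * x" by simp
  finally show ?thesis .
qed

lemma lattice_point_in_ball_quad:
  assumes "x \<ge> 0" "a \<ge> 1" "a \<le> nat \<lfloor>sqrt (x / 2)\<rfloor>" "b \<le> nat \<lfloor>sqrt (x / 2)\<rfloor>"
  shows "lattice_point (a, b) \<in> ball_quad x"
proof -
  have "real c \<le> sqrt (x / 2)" if "c \<le> nat \<lfloor>sqrt (x / 2)\<rfloor>" for c
    using that assms(1) by (simp add: le_nat_iff le_floor_iff)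
  then have "(real c)\<^sup>2 \<le> x / 2" if "c \<le> nat \<lfloor>sqrt (x / 2)\<rfloor>" for c
    using that assms(1) by (metis divide_nonneg_pos of_nat_0_le_iff power_mono real_sqrt_pow2 zero_less_numeral)
  from this[OF assms(3)] this[OF assms(4)] show ?thesis
    using assms(2) by (simp add: ball_quad_def lattice_point_in_quad gnorm_lattice_point)
qed

text \<open>The ball contains a box of \<open>m * (m + 1)\<close> points with \<open>m\<close> the
  floor of \<open>sqrt (x / 2)\<close>. If \<open>m = 0\<close>, then \<open>x < 2\<close> and the
  single point \<open>1\<close> is enough.\<close>

lemma card_ball_quad_ge:
  assumes "x \<ge> 1" shows "real (card (ball_quad x)) \<ge> x / 4"
proof -
  define m where "m = nat \<lfloor>sqrt (x / 2)\<rfloor>"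
  have m: "sqrt (x / 2) < real m + 1" using assms unfolding m_def by linarith
  have "x / 2 = (sqrt (x / 2))\<^sup>2" using assms by simp
  also have "\<dots> < (real m + 1)\<^sup>2" using m assms by (intro power_strict_mono) auto
  finally have x: "x / 2 < (real m + 1)\<^sup>2" .
  show ?thesis
  proof (cases "m = 0")
    case True
    have "lattice_point (1, 0) \<in> ball_quad x"
      using assms by (simp add: ball_quad_def lattice_point_in_quad gnorm_lattice_point)
    then have "card (ball_quad x) \<ge> 1"
      using finite_ball_quad[of x] by (metis One_nat_def Suc_leI card_gt_0_iff empty_iff)
    then show ?thesis using True x by simp
  next
    case False
    have "lattice_point ` ({1..m} \<times> {0..m}) \<subseteq> ball_quad x"
      using assms by (auto simp: m_def intro!: lattice_point_in_ball_quad)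
    then have "card (lattice_point ` ({1..m} \<times> {0..m})) \<le> card (ball_quad x)"
      by (intro card_mono finite_ball_quad)
    also have "card (lattice_point ` ({1..m} \<times> {0..m})) = m * (m + 1)"
      by (subst card_image) (simp_all add: inj_lattice_point)
    finally have "real (m * (m + 1)) \<le> real (card (ball_quad x))" by (rule of_nat_mono)
    moreover have "(real m + 1)\<^sup>2 \<le> 2 * real (m * (m + 1))"
      using False by (cases m) (simp_all add: power2_eq_square algebra_simps)
    ultimately show ?thesis using x by linarith
  qed
qed

section \<open>Logarithmic growth of the sum of inverse norms\<close>

text \<open>The true constant is \<open>\<pi> / 4\<close>. Any constant below \<open>1\<close> suffices: its power \<open>2 ^ (k - 1) - 1\<close>
  has to beat \<open>4 ^ k\<close>, so that the implied constant of the upper bound does not depend on \<open>k\<close>.\<close>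

lemma sum_inverse_sum_squares_row:
  assumes "a \<ge> 1"
  shows "(\<Sum>b=1..a. 1 / ((real a)\<^sup>2 + (real b)\<^sup>2)) \<le> 5 / 6 * (1 / real a)"
proof -
  have sq: "(\<Sum>b=1..n. (real b)\<^sup>2) \<ge> real n ^ 3 / 3" for n
    by (induction n) (auto simp: power2_eq_square power3_eq_cube algebra_simps)
  \<comment> \<open>With \<open>u = a\<^sup>2\<close> and \<open>v = b\<^sup>2 \<le> u\<close>, the
    bound \<open>1 / (u + v) \<le> 1 / u - v / (2 * u\<^sup>2)\<close> holds. Summing over
    \<open>b\<close> saves at least \<open>1 / (6 * a)\<close> from the trivial
    \<open>1 / a\<close>, hence \<open>5 / 6\<close>.\<close>
  have "(\<Sum>b=1..a. 1 / ((real a)\<^sup>2 + (real b)\<^sup>2)) \<le>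
      (\<Sum>b=1..a. 1 / (real a)\<^sup>2 - (real b)\<^sup>2 / (2 * real a ^ 4))"
  proof (rule sum_mono)
    fix b assume b: "b \<in> {1..a}"
    define u v where "u = (real a)\<^sup>2" and "v = (real b)\<^sup>2"
    have uv: "u > 0" "v \<ge> 0" "v \<le> u" using b assms by (auto simp: u_def v_def power_mono)
    have "v * v \<le> u * v" using uv by (intro mult_right_mono)
    then have "2 * u * u \<le> (2 * u - v) * (u + v)" by (simp add: algebra_simps)
    then have "1 / (u + v) \<le> (2 * u - v) / (2 * u * u)" using uv by (simp add: field_simps)
    also have "\<dots> = 1 / u - v / (2 * u\<^sup>2)" using uv by (simp add: field_simps power2_eq_square)
    finally show "1 / ((real a)\<^sup>2 + (real b)\<^sup>2) \<le> 1 / (real a)\<^sup>2 - (real b)\<^sup>2 / (2 * real a ^ 4)"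
      by (simp add: u_def v_def flip: power_mult)
  qed
  also have "\<dots> = 1 / real a - (\<Sum>b=1..a. (real b)\<^sup>2) / (2 * real a ^ 4)"
    using assms by (simp add: sum_subtractf sum_divide_distrib power2_eq_square)
  also have "\<dots> \<le> 1 / real a - (real a ^ 3 / 3) / (2 * real a ^ 4)"
    using sq[of a] by (intro diff_left_mono divide_right_mono) auto
  also have "\<dots> = 5 / 6 * (1 / real a)"
    using assms by (simp add: field_simps power_numeral_reduce)
  finally show ?thesis .
qed

text \<open>Going from \<open>m\<close> to \<open>m + 1\<close> adds a row and a column, each
  contributing at most \<open>5 / 6 * (1 / (m + 1))\<close>.\<close>

lemma sum_inverse_sum_squares_box:
  "(\<Sum>a=1..m. \<Sum>b=1..m. 1 / ((real a)\<^sup>2 + (real b)\<^sup>2)) \<le> 5 / 3 * harm m"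
proof (induction m)
  case (Suc m)
  let ?f = "\<lambda>a b. 1 / ((real a)\<^sup>2 + (real b)\<^sup>2)"
  have "(\<Sum>a=1..Suc m. \<Sum>b=1..Suc m. ?f a b) =
      (\<Sum>a=1..m. \<Sum>b=1..m. ?f a b) + (\<Sum>a=1..m. ?f a (Suc m)) + (\<Sum>b=1..Suc m. ?f (Suc m) b)"
    by (simp add: sum.distrib)
  also have "(\<Sum>a=1..m. ?f a (Suc m)) = (\<Sum>b=1..m. ?f (Suc m) b)"
    by (simp add: add.commute)
  also have "\<dots> \<le> (\<Sum>b=1..Suc m. ?f (Suc m) b)" by simp
  also have "(\<Sum>a=1..m. \<Sum>b=1..m. ?f a b) + (\<Sum>b=1..Suc m. ?f (Suc m) b) +
      (\<Sum>b=1..Suc m. ?f (Suc m) b) \<le> 5 / 3 * harm (Suc m)"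
  proof -
    have "(\<Sum>b=1..Suc m. ?f (Suc m) b) \<le> 5 / 6 * (1 / real (Suc m))"
      by (rule sum_inverse_sum_squares_row) simp
    moreover have "harm (Suc m) = harm m + 1 / real (Suc m)"
      by (simp only: harm_Suc inverse_eq_divide)
    ultimately show ?thesis using Suc.IH by linarith
  qed
  finally show ?case by simp
qed (simp add: harm_def)

text \<open>The real axis contributes at most \<open>2\<close>, the rest at most
  \<open>5 / 3 * harm m\<close> with \<open>harm m \<le> 1 + ln x / 2\<close>, because
  \<open>m \<le> sqrt x\<close>.\<close>

lemma inverse_norm_sum_le:
  assumes "x \<ge> 1" shows "inverse_norm_sum x \<le> 11 / 3 + 5 / 6 * ln x"
proof -
  define m where "m = nat \<lfloor>sqrt x\<rfloor>"
  have sx: "sqrt x \<ge> 1" using assms by simp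
  then have m: "m \<ge> 1" "real m \<le> sqrt x" by (simp_all add: m_def le_nat_iff le_floor_iff)
  have "inverse_norm_sum x \<le> (\<Sum>z\<in>lattice_point ` ({1..m} \<times> {0..m}). 1 / real (gnorm z))"
    unfolding inverse_norm_sum_def
    using ball_quad_subset_lattice[of x] assms by (intro sum_mono2) (auto simp: m_def)
  also have "\<dots> = (\<Sum>(a, b)\<in>{1..m} \<times> {0..m}. 1 / ((real a)\<^sup>2 + (real b)\<^sup>2))"
    by (subst sum.reindex) (auto simp: inj_lattice_point gnorm_lattice_point intro!: sum.cong)
  also have "\<dots> = (\<Sum>a=1..m. \<Sum>b=0..m. 1 / ((real a)\<^sup>2 + (real b)\<^sup>2))"
    by (simp add: sum.cartesian_product)
  also have "\<dots> = (\<Sum>a=1..m. 1 / (real a)\<^sup>2 + (\<Sum>b=1..m. 1 / ((real a)\<^sup>2 + (real b)\<^sup>2)))"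
    by (simp add: sum.atLeast_Suc_atMost)
  also have "\<dots> = (\<Sum>a=1..m. 1 / (real a)\<^sup>2) + (\<Sum>a=1..m. \<Sum>b=1..m. 1 / ((real a)\<^sup>2 + (real b)\<^sup>2))"
    by (rule sum.distrib)
  also have "\<dots> \<le> 2 + 5 / 3 * harm m"
    by (intro add_mono sum_inverse_squares_le sum_inverse_sum_squares_box) auto
  also have "harm m \<le> 1 + ln (real m)"
    using euler_mascheroni_sequence_decreasing[of 1 m] m(1) by (simp add: harm_expand)
  also have "ln (real m) \<le> ln (sqrt x)" using m by (intro ln_mono) auto
  also have "ln (sqrt x) = ln x / 2" using assms by (simp add: ln_sqrt)
  finally show ?thesis by (simp add: ring_distribs)
qed

text \<open>It suffices to sum over the triangle \<open>b < a \<le> m\<close>, where the norm is at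
  most \<open>2 * a\<^sup>2\<close>: each column contributes at least \<open>1 / (2 * a)\<close>, so
  half a harmonic sum results.\<close>

lemma inverse_norm_sum_ge:
  assumes "x \<ge> 1" shows "inverse_norm_sum x \<ge> (ln x - 1) / 4"
proof -
  define m where "m = nat \<lfloor>sqrt (x / 2)\<rfloor>"
  define L where "L = Sigma {1..m} (\<lambda>a. {0..<a})"
  have m: "sqrt (x / 2) \<le> real m + 1" using assms unfolding m_def by linarith
  have "ln 2 < (1::real)" using ln_2_less_1 .
  then have "(ln x - 1) / 4 \<le> ln (sqrt (x / 2)) / 2"
    using assms by (simp add: ln_sqrt ln_div)
  also have "ln (sqrt (x / 2)) \<le> ln (real m + 1)" using m assms by simp
  also have "\<dots> \<le> harm m" by (rule ln_le_harm)
  also have "harm m / 2 = (\<Sum>a=1..m. \<Sum>b\<in>{0..<a}. 1 / (2 * (real a)\<^sup>2))"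
    by (simp add: harm_def sum_divide_distrib power2_eq_square field_simps)
  also have "\<dots> = (\<Sum>(a, b)\<in>L. 1 / (2 * (real a)\<^sup>2))"
    unfolding L_def by (subst sum.Sigma) auto
  also have "\<dots> \<le> (\<Sum>p\<in>L. 1 / real (gnorm (lattice_point p)))"
  proof (rule sum_mono)
    fix p assume "p \<in> L"
    then obtain a b where p: "p = (a, b)" "a \<ge> 1" "b < a" by (auto simp: L_def)
    have "(real b)\<^sup>2 \<le> (real a)\<^sup>2" using p by (intro power_mono) auto
    then have "1 / (2 * (real a)\<^sup>2) \<le> 1 / ((real a)\<^sup>2 + (real b)\<^sup>2)"
      using p by (intro divide_left_mono mult_pos_pos) (auto simp: add_pos_nonneg)
    then show "(case p of (a, b) \<Rightarrow> 1 / (2 * (real a)\<^sup>2)) \<le> 1 / real (gnorm (lattice_point p))"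
      by (simp add: p gnorm_lattice_point)
  qed
  also have "\<dots> = (\<Sum>z\<in>lattice_point ` L. 1 / real (gnorm z))"
    by (subst sum.reindex) (auto simp: inj_lattice_point)
  also have "\<dots> \<le> inverse_norm_sum x"
    unfolding inverse_norm_sum_def using assms
    by (intro sum_mono2 finite_ball_quad)
      (auto simp: L_def m_def intro!: lattice_point_in_ball_quad)
  finally show ?thesis by simp
qed

lemma inverse_norm_sum_nonneg: "inverse_norm_sum x \<ge> 0"
  by (simp add: inverse_norm_sum_def sum_nonneg)

lemma inverse_norm_sum_mono: "x \<le> y \<Longrightarrow> inverse_norm_sum x \<le> inverse_norm_sum y"
  unfolding inverse_norm_sum_def by (intro sum_mono2 finite_ball_quad) (auto simp: ball_quad_def)

section \<open>Bounds for the number of all tuples\<close>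

lemma sum_inverse_prod_gnorm:
  assumes "finite J"
  shows "(\<Sum>z\<in>J \<rightarrow>\<^sub>E ball_quad x. 1 / real (\<Prod>S\<in>J. gnorm (z S))) = inverse_norm_sum x ^ card J"
proof -
  have "(\<Sum>z\<in>J \<rightarrow>\<^sub>E ball_quad x. 1 / real (\<Prod>S\<in>J. gnorm (z S))) =
      (\<Sum>z\<in>J \<rightarrow>\<^sub>E ball_quad x. \<Prod>S\<in>J. 1 / real (gnorm (z S)))"
    by (simp add: prod_dividef)
  also have "\<dots> = inverse_norm_sum x ^ card J"
    using assms prod_sum_PiE[of J "\<lambda>_. ball_quad x" "\<lambda>_ c. 1 / real (gnorm c)"]
    by (simp add: finite_ball_quad inverse_norm_sum_def)
  finally show ?thesis .
qed

lemma prod_gnorm_insert_upd: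
  assumes "finite J" "s \<notin> J"
  shows "(\<Prod>S\<in>insert s J. gnorm ((z(s := c)) S)) = gnorm c * (\<Prod>S\<in>J. gnorm (z S))"
proof -
  have "(\<Prod>S\<in>J. gnorm ((z(s := c)) S)) = (\<Prod>S\<in>J. gnorm (z S))"
    using assms(2) by (intro prod.cong) auto
  then show ?thesis using assms by simp
qed

text \<open>The coordinates in \<open>J\<close> have norm at most \<open>x\<close> each. Once they
  are fixed, the coordinate \<open>s\<close> lies in a ball of radius \<open>x\<close> divided by
  the product of their norms, so \<open>card_ball_quad_le\<close> applies.\<close>

lemma card_tuples_le_upper:
  assumes "finite J" "s \<notin> J" "x \<ge> 0"
  shows "real (card (tuples_le (insert s J) x)) \<le> 2 * x * inverse_norm_sum x ^ card J"
proof -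
  define A where "A z = ball_quad (x / real (\<Prod>S\<in>J. gnorm (z S)))" for z :: "'a \<Rightarrow> gint"
  have finE: "finite (J \<rightarrow>\<^sub>E ball_quad x)" using assms(1) finite_ball_quad by (intro finite_PiE) auto
  have "tuples_le (insert s J) x \<subseteq> (\<lambda>(z, c). z(s := c)) ` Sigma (J \<rightarrow>\<^sub>E ball_quad x) A"
  proof
    fix w assume w: "w \<in> tuples_le (insert s J) x"
    \<comment> \<open>The value at \<open>s\<close> is reset to keep \<open>z\<close> extensional on
      \<open>J\<close>.\<close>
    define z where "z = w(s := undefined)"
    have wz: "w = z(s := w s)" by (simp add: z_def)
    have zJ: "z \<in> J \<rightarrow>\<^sub>E quad" "w s \<in> quad" "w \<in> insert s J \<rightarrow>\<^sub>E quad"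
      using w assms(2) by (auto simp: tuples_le_def z_def PiE_iff extensional_def)
    have le: "real (\<Prod>S\<in>insert s J. gnorm (w S)) \<le> x" using w by (simp add: tuples_le_def)
    have "(\<Prod>S\<in>insert s J. gnorm (w S)) = gnorm (w s) * (\<Prod>S\<in>J. gnorm (z S))"
      using prod_gnorm_insert_upd[OF assms(1,2), of z "w s"] wz by simp
    then have "real (gnorm (w s)) * real (\<Prod>S\<in>J. gnorm (z S)) \<le> x"
      using le by (simp del: of_nat_prod)
    moreover have "real (\<Prod>S\<in>J. gnorm (z S)) > 0"
      using prod_gnorm_quad(1)[OF assms(1) zJ(1)] by (simp del: of_nat_prod)
    ultimately have "w s \<in> A z"
      using zJ(2) by (simp add: A_def ball_quad_def pos_le_divide_eq del: of_nat_prod)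
    moreover have "z \<in> J \<rightarrow>\<^sub>E ball_quad x"
    proof -
      have "real (gnorm (z S)) \<le> x" if "S \<in> J" for S
      proof -
        have "gnorm (w S) \<le> (\<Prod>S\<in>insert s J. gnorm (w S))"
          using prod_gnorm_quad(2)[OF _ zJ(3)] assms(1) that by auto
        moreover have "z S = w S" using that assms(2) by (auto simp: z_def)
        ultimately show ?thesis using le by (metis of_nat_mono order.trans)
      qed
      then show ?thesis using zJ(1) by (auto simp: ball_quad_def PiE_iff)
    qed
    ultimately show "w \<in> (\<lambda>(z, c). z(s := c)) ` Sigma (J \<rightarrow>\<^sub>E ball_quad x) A"
      using wz by (intro image_eqI[of _ _ "(z, w s)"]) auto
  qed
  then have "card (tuples_le (insert s J) x) \<le> card (Sigma (J \<rightarrow>\<^sub>E ball_quad x) A)"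
    using finE by (intro surj_card_le finite_SigmaI) (auto simp: A_def finite_ball_quad)
  also have "\<dots> = (\<Sum>z\<in>J \<rightarrow>\<^sub>E ball_quad x. card (A z))"
    using finE by (simp add: A_def finite_ball_quad)
  finally have "real (card (tuples_le (insert s J) x)) \<le>
      real (\<Sum>z\<in>J \<rightarrow>\<^sub>E ball_quad x. card (A z))" by (rule of_nat_mono)
  also have "\<dots> = (\<Sum>z\<in>J \<rightarrow>\<^sub>E ball_quad x. real (card (A z)))" by simp
  also have "\<dots> \<le> (\<Sum>z\<in>J \<rightarrow>\<^sub>E ball_quad x. 2 * x * (1 / real (\<Prod>S\<in>J. gnorm (z S))))"
  proof (rule sum_mono)
    fix z :: "'a \<Rightarrow> gint"
    show "real (card (A z)) \<le> 2 * x * (1 / real (\<Prod>S\<in>J. gnorm (z S)))"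
      using card_ball_quad_le[of "x / real (\<Prod>S\<in>J. gnorm (z S))"] assms(3)
      by (simp add: A_def del: of_nat_prod)
  qed
  also have "\<dots> = 2 * x * inverse_norm_sum x ^ card J"
    by (simp only: sum_distrib_left[symmetric] sum_inverse_prod_gnorm[OF assms(1)])
  finally show ?thesis .
qed

text \<open>With norms at most \<open>r\<close> on \<open>J\<close>, the product of these norms
  stays below \<open>r ^ card J \<le> x\<close>. The ball left for the coordinate \<open>s\<close>
  then has radius at least \<open>1\<close>, as \<open>card_ball_quad_ge\<close> requires.\<close>

lemma card_tuples_le_lower:
  assumes "finite J" "s \<notin> J" "r \<ge> 1" "r ^ card J \<le> x"
  shows "real (card (tuples_le (insert s J) x)) \<ge> x / 4 * inverse_norm_sum r ^ card J"
proof -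
  define A where "A z = ball_quad (x / real (\<Prod>S\<in>J. gnorm (z S)))" for z :: "'a \<Rightarrow> gint"
  have finE: "finite (J \<rightarrow>\<^sub>E ball_quad r)" using assms(1) finite_ball_quad by (intro finite_PiE) auto
  have le: "real (\<Prod>S\<in>J. gnorm (z S)) \<le> x" "real (\<Prod>S\<in>J. gnorm (z S)) \<ge> 1"
    if z: "z \<in> J \<rightarrow>\<^sub>E ball_quad r" for z
  proof -
    have zq: "z \<in> J \<rightarrow>\<^sub>E quad" using z by (auto simp: ball_quad_def PiE_iff)
    show "real (\<Prod>S\<in>J. gnorm (z S)) \<ge> 1"
      using prod_gnorm_quad(1)[OF assms(1) zq] by (simp del: of_nat_prod)
    have "real (\<Prod>S\<in>J. gnorm (z S)) \<le> (\<Prod>S\<in>J. r)"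
      unfolding of_nat_prod using z by (intro prod_mono) (auto simp: ball_quad_def PiE_iff)
    then show "real (\<Prod>S\<in>J. gnorm (z S)) \<le> x" using assms(4) by (simp del: of_nat_prod)
  qed
  have "x / 4 * inverse_norm_sum r ^ card J =
      (\<Sum>z\<in>J \<rightarrow>\<^sub>E ball_quad r. x / 4 * (1 / real (\<Prod>S\<in>J. gnorm (z S))))"
    by (simp only: sum_distrib_left[symmetric] sum_inverse_prod_gnorm[OF assms(1)])
  also have "\<dots> \<le> (\<Sum>z\<in>J \<rightarrow>\<^sub>E ball_quad r. real (card (A z)))"
  proof (rule sum_mono)
    fix z assume z: "z \<in> J \<rightarrow>\<^sub>E ball_quad r"
    have "x / real (\<Prod>S\<in>J. gnorm (z S)) \<ge> 1"
      using le[OF z] by (simp add: le_divide_eq del: of_nat_prod)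
    from card_ball_quad_ge[OF this]
    show "x / 4 * (1 / real (\<Prod>S\<in>J. gnorm (z S))) \<le> real (card (A z))"
      by (simp add: A_def del: of_nat_prod)
  qed
  also have "\<dots> = real (card (Sigma (J \<rightarrow>\<^sub>E ball_quad r) A))"
    using finE by (simp add: A_def finite_ball_quad)
  also have "\<dots> \<le> real (card (tuples_le (insert s J) x))"
  proof (intro of_nat_mono card_inj_on_le[of "\<lambda>(z, c). z(s := c)"])
    show "finite (tuples_le (insert s J) x)" using assms(1) by (intro finite_tuples_le) simp
    show "inj_on (\<lambda>(z, c). z(s := c)) (Sigma (J \<rightarrow>\<^sub>E ball_quad r) A)"
    proof (rule inj_onI, clarify)
      fix z c z' c' assume z: "z \<in> J \<rightarrow>\<^sub>E ball_quad r" "z' \<in> J \<rightarrow>\<^sub>E ball_quad r"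
        and eq: "z(s := c) = z'(s := c')"
      have "z s = z' s" using PiE_arb[OF z(1) assms(2)] PiE_arb[OF z(2) assms(2)] by simp
      then have "z = z'" using eq by (metis fun_upd_triv fun_upd_upd)
      then show "z = z' \<and> c = c'" using eq by (metis fun_upd_same)
    qed
    show "(\<lambda>(z, c). z(s := c)) ` Sigma (J \<rightarrow>\<^sub>E ball_quad r) A \<subseteq> tuples_le (insert s J) x"
    proof clarify
      fix z c assume z: "z \<in> J \<rightarrow>\<^sub>E ball_quad r" and c: "c \<in> A z"
      have "real (gnorm c) * real (\<Prod>S\<in>J. gnorm (z S)) \<le> x"
        using c le[OF z] by (simp add: A_def ball_quad_def le_divide_eq del: of_nat_prod)
      then have "real (\<Prod>S\<in>insert s J. gnorm ((z(s := c)) S)) \<le> x"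
        unfolding prod_gnorm_insert_upd[OF assms(1,2)] by (simp del: of_nat_prod)
      moreover have "z(s := c) \<in> insert s J \<rightarrow>\<^sub>E quad"
        using z c by (auto simp: A_def ball_quad_def PiE_iff extensional_def)
      ultimately show "z(s := c) \<in> tuples_le (insert s J) x"
        unfolding tuples_le_def by blast
    qed
  qed
  finally show ?thesis .
qed

text \<open>All tuples are decomposed into good ones. Parameters outside a finite set
  \<open>P0\<close> account for at most half of the lower bound for \<open>T x\<close>, and each
  parameter in \<open>P0\<close> accounts for at most \<open>G x\<close>.\<close>

lemma card_good_tuples_lower:
  fixes s :: 'a
  assumes "finite J" "s \<notin> J"
  shows "\<exists>c>0. \<exists>x0. \<forall>x\<ge>x0.
    real (card {y \<in> tuples_le (insert s J) x. good (insert s J) y}) \<ge> c * x * ln x ^ card J"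
proof -
  define I where "I = insert s J"
  define q where "q = card J"
  define T where "T x = real (card (tuples_le I x))" for x
  define G where "G x = real (card {y \<in> tuples_le I x. good I y})" for x
  have I: "finite I" using assms(1) by (simp add: I_def)
  \<comment> \<open>The constant of the lower bound for \<open>T\<close>: \<open>1 / 4\<close> from
    the ball count, and \<open>ln x / (8 * (q + 1))\<close> as a lower bound for each factor
    \<open>inverse_norm_sum r\<close>.\<close>
  define a where "a = (1 / (8 * (real q + 1))) ^ q / 4"
  \<comment> \<open>Chosen so that the tail, bounded by \<open>2 * 5 ^ q * \<epsilon>\<close> times
    \<open>x * ln x ^ q\<close>, has constant \<open>a / 2\<close>.\<close>
  define \<epsilon> where "\<epsilon> = a / (4 * 5 ^ q)"
  have a: "a > 0" by (simp add: a_def)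
  then have "\<epsilon> > 0" by (simp add: \<epsilon>_def)
  obtain P0 where P0: "finite P0"
    "\<And>P. finite P \<Longrightarrow> P \<subseteq> pattern_tuples I - P0 \<Longrightarrow> (\<Sum>\<alpha>\<in>P. 1 / real (weight I \<alpha>)) \<le> \<epsilon>"
    using small_tail[of "pattern_tuples I" "\<lambda>\<alpha>. 1 / real (weight I \<alpha>)" "6 ^ card (patterns I)" \<epsilon>]
      sum_inverse_weight_le[OF I] \<open>\<epsilon> > 0\<close> by metis
  have lower: "T x \<ge> a * x * ln x ^ q" if x: "ln x \<ge> 2 * (real q + 1)" "x \<ge> 1" for x
  proof -
    \<comment> \<open>This radius satisfies \<open>r ^ q \<le> x\<close>, while \<open>ln r\<close>
      is still a fixed proportion of \<open>ln x\<close>.\<close>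
    define r where "r = x powr (1 / (real q + 1))"
    have r: "r \<ge> 1" using x(2) by (simp add: r_def ge_one_powr_ge_zero)
    have "r ^ q = x powr (real q / (real q + 1))"
      using x(2) by (simp add: r_def powr_powr flip: powr_realpow)
    also have "\<dots> \<le> x powr 1" using x(2) by (intro powr_mono) auto
    finally have rq: "r ^ q \<le> x" using x(2) by simp
    have "t / 8 \<le> (t - 1) / 4" if "t \<ge> 2" for t :: real using that by simp
    moreover have "ln x / (real q + 1) \<ge> 2" using x(1) by (simp add: pos_le_divide_eq)
    ultimately have "ln x / (real q + 1) / 8 \<le> (ln x / (real q + 1) - 1) / 4" by blast
    then have "ln x / (8 * (real q + 1)) \<le> (ln x / (real q + 1) - 1) / 4"
      by (simp add: mult.commute)
    also have "ln x / (real q + 1) = ln r" using x(2) by (simp add: r_def ln_powr)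
    also have "(ln r - 1) / 4 \<le> inverse_norm_sum r" by (rule inverse_norm_sum_ge[OF r])
    finally have "(ln x / (8 * (real q + 1))) ^ q \<le> inverse_norm_sum r ^ q"
      using x(2) by (intro power_mono) auto
    then have "x / 4 * (ln x / (8 * (real q + 1))) ^ q \<le> x / 4 * inverse_norm_sum r ^ q"
      using x(2) by (intro mult_left_mono) auto
    also have "\<dots> \<le> T x"
      using card_tuples_le_lower[OF assms r, of x] rq by (simp add: T_def I_def q_def)
    finally show ?thesis by (simp add: a_def power_divide field_simps)
  qed
  \<comment> \<open>For \<open>ln x \<ge> 1\<close> the bound \<open>11 / 3 + 5 / 6 * ln x\<close>
    is at most \<open>5 * ln x\<close>. The factor \<open>1 / w\<close> is what makes the sum over
    weights small.\<close>
  have upper: "T (x / w) \<le> 2 * (5 * ln x) ^ q * x * (1 / w)" if x: "ln x \<ge> 1" "x \<ge> 1" "w \<ge> 1" for x w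
  proof -
    have "inverse_norm_sum (x / w) \<le> inverse_norm_sum x"
      using x by (intro inverse_norm_sum_mono) (simp add: field_simps)
    also have "\<dots> \<le> 5 * ln x" using inverse_norm_sum_le[OF x(2)] x(1) by linarith
    finally have "inverse_norm_sum (x / w) ^ q \<le> (5 * ln x) ^ q"
      by (intro power_mono inverse_norm_sum_nonneg)
    then have "2 * (x / w) * inverse_norm_sum (x / w) ^ q \<le> 2 * (x / w) * (5 * ln x) ^ q"
      using x by (intro mult_left_mono) auto
    moreover have "T (x / w) \<le> 2 * (x / w) * inverse_norm_sum (x / w) ^ q"
      using card_tuples_le_upper[OF assms, of "x / w"] x by (simp add: T_def I_def q_def)
    ultimately show ?thesis by (simp add: mult_ac)
  qed
  have GT: "G x \<le> T x" for x
    unfolding G_def T_def by (intro of_nat_mono card_mono finite_tuples_le I) auto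
  have G_mono: "G x \<le> G y" if "x \<le> y" for x y
    unfolding G_def using that
    by (intro of_nat_mono card_mono finite_subset[OF _ finite_tuples_le[OF I, of y]])
      (auto simp: tuples_le_def)
  \<comment> \<open>The summand \<open>1\<close> next to \<open>card P0\<close> keeps the
    denominator positive when \<open>P0\<close> is empty.\<close>
  define c where "c = a / (2 * (real (card P0) + 1))"
  have "c > 0" using a by (simp add: c_def)
  moreover have "G x \<ge> c * x * ln x ^ q" if x: "x \<ge> exp (2 * (real q + 1))" for x
  proof -
    have x1: "x > 0" using x by (rule order.strict_trans2[OF exp_gt_zero])
    then have lnx: "ln x \<ge> 2 * (real q + 1)" using x by (simp add: ln_ge_iff)
    then have ln1: "ln x \<ge> 1" by simp
    have x1: "x \<ge> 1"
      using x one_le_exp_iff[of "2 * (real q + 1)"] by (rule_tac order.trans[OF _ x]) simp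
    obtain P where P: "finite P" "P \<subseteq> pattern_tuples I"
      "card (tuples_le I x) \<le> (\<Sum>\<alpha>\<in>P. card {y \<in> tuples_le I (x / real (weight I \<alpha>)). good I y})"
      by (rule card_tuples_le_decomposition[OF I])
    have w1: "real (weight I \<alpha>) \<ge> 1" if "\<alpha> \<in> P" for \<alpha>
      using weight_pos[of \<alpha> I] P(2) that by auto
    have "T x \<le> real (\<Sum>\<alpha>\<in>P. card {y \<in> tuples_le I (x / real (weight I \<alpha>)). good I y})"
      unfolding T_def by (rule of_nat_mono[OF P(3)])
    also have "\<dots> = (\<Sum>\<alpha>\<in>P. G (x / real (weight I \<alpha>)))" by (simp add: G_def)
    \<comment> \<open>On \<open>P0\<close> monotonicity of \<open>G\<close> is used, outside it the
      upper bound for \<open>T\<close> and the choice of \<open>P0\<close>.\<close>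
    also have "\<dots> = (\<Sum>\<alpha>\<in>P \<inter> P0. G (x / real (weight I \<alpha>))) + (\<Sum>\<alpha>\<in>P - P0. G (x / real (weight I \<alpha>)))"
      by (rule sum.Int_Diff[OF P(1)])
    also have "(\<Sum>\<alpha>\<in>P \<inter> P0. G (x / real (weight I \<alpha>))) \<le> (\<Sum>\<alpha>\<in>P \<inter> P0. G x)"
    proof (intro sum_mono G_mono)
      fix \<alpha> assume "\<alpha> \<in> P \<inter> P0"
      then show "x / real (weight I \<alpha>) \<le> x"
        using w1[of \<alpha>] x1 by (simp add: divide_le_eq)
    qed
    also have "(\<Sum>\<alpha>\<in>P \<inter> P0. G x) \<le> real (card P0) * G x"
      using P0(1) by (simp add: G_def mult_right_mono card_mono)
    also have "(\<Sum>\<alpha>\<in>P - P0. G (x / real (weight I \<alpha>))) \<le>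
        (\<Sum>\<alpha>\<in>P - P0. 2 * (5 * ln x) ^ q * x * (1 / real (weight I \<alpha>)))"
      using w1 by (intro sum_mono order.trans[OF GT upper] ln1 x1) auto
    also have "\<dots> = 2 * (5 * ln x) ^ q * x * (\<Sum>\<alpha>\<in>P - P0. 1 / real (weight I \<alpha>))"
      by (simp only: sum_distrib_left)
    also have "\<dots> \<le> 2 * (5 * ln x) ^ q * x * \<epsilon>"
      using ln1 x1 P by (intro mult_left_mono P0(2)) auto
    also have "\<dots> = a / 2 * x * ln x ^ q" by (simp add: \<epsilon>_def power_mult_distrib)
    finally have "T x \<le> real (card P0) * G x + a / 2 * x * ln x ^ q" by simp
    moreover have "a * x * ln x ^ q \<le> T x" by (rule lower[OF lnx x1])
    ultimately have "a / 2 * x * ln x ^ q \<le> real (card P0) * G x" by simp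
    also have "\<dots> \<le> (real (card P0) + 1) * G x"
      by (intro mult_right_mono) (auto simp: G_def)
    finally show ?thesis by (simp add: c_def field_simps)
  qed
  ultimately show ?thesis unfolding G_def I_def q_def by blast
qed

lemma card_tuples_le_eq_sum:
  assumes "finite I"
  shows "card {y \<in> tuples_le I (real M). R y} = (\<Sum>n=1..M. card {y \<in> tuples I n. R y})"
proof -
  have eq: "{y \<in> tuples_le I (real M). R y} = (\<Union>n\<in>{1..M}. {y \<in> tuples I n. R y})"
    using prod_gnorm_quad(1)[OF assms] by (auto simp: tuples_le_def tuples_def simp del: of_nat_prod)
  show ?thesis unfolding eq
    by (rule card_UN_disjoint) (auto simp: finite_tuples[OF assms], auto simp: tuples_def)
qed

section \<open>The distance energy of the grid\<close>

text \<open>The grid as Gaussian integers, so that squared distances become norms of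
  differences.\<close>

definition int_grid :: "nat \<Rightarrow> gint set"
  where "int_grid m = {z. gre z \<in> {1..int m} \<and> gim z \<in> {1..int m}}"

definition grid_pairs :: "nat \<Rightarrow> nat \<Rightarrow> (gint \<times> gint) set"
  where "grid_pairs m n = {(p, q) \<in> int_grid m \<times> int_grid m. gnorm (q - p) = n}"

definition plane_point :: "gint \<Rightarrow> real \<times> real"
  where "plane_point z = (real_of_int (gre z), real_of_int (gim z))"

lemma int_grid_eq: "int_grid m = (\<lambda>(a, b). GInt a b) ` ({1..int m} \<times> {1..int m})"
  by (force simp: int_grid_def image_iff gint_eq_iff)

lemma finite_int_grid: "finite (int_grid m)" and card_int_grid: "card (int_grid m) = m\<^sup>2"
proof -
  show "finite (int_grid m)" by (simp add: int_grid_eq)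
  have "inj_on (\<lambda>(a, b). GInt a b) ({1..int m} \<times> {1..int m})" by (auto simp: inj_on_def)
  then show "card (int_grid m) = m\<^sup>2" by (simp add: int_grid_eq card_image power2_eq_square)
qed

lemma finite_grid_pairs: "finite (grid_pairs m n)"
  by (rule finite_subset[of _ "int_grid m \<times> int_grid m"]) (auto simp: grid_pairs_def finite_int_grid)

lemma square_grid_eq: "square_grid N = plane_point ` int_grid (nat \<lfloor>sqrt (real N)\<rfloor>)"
proof -
  have "int (nat \<lfloor>sqrt (real N)\<rfloor>) = \<lfloor>sqrt (real N)\<rfloor>" by simp
  then show ?thesis
    unfolding int_grid_eq square_grid_def int_segment_def
    by (force simp: plane_point_def image_iff)
qed

lemma inj_plane_point: "inj plane_point"
  by (auto simp: inj_def plane_point_def gint_eq_iff)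

lemma dist_plane_point: "dist (plane_point p) (plane_point q) = sqrt (real (gnorm (q - p)))"
proof -
  have "real (gnorm (q - p)) = real_of_int (int (gnorm (q - p)))" by simp
  also have "\<dots> = (real_of_int (gre q - gre p))\<^sup>2 + (real_of_int (gim q - gim p))\<^sup>2"
    unfolding int_gnorm by simp
  finally show ?thesis
    by (simp add: plane_point_def dist_Pair_Pair dist_real_def power2_commute)
qed

lemma gnorm_grid_diff_le:
  assumes "p \<in> int_grid m" "q \<in> int_grid m" shows "gnorm (q - p) \<le> 2 * m\<^sup>2"
proof -
  have "\<bar>gre (q - p)\<bar> \<le> \<bar>int m\<bar>" "\<bar>gim (q - p)\<bar> \<le> \<bar>int m\<bar>"
    using assms by (auto simp: int_grid_def)
  then have "(gre (q - p))\<^sup>2 \<le> (int m)\<^sup>2" "(gim (q - p))\<^sup>2 \<le> (int m)\<^sup>2"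
    by (simp_all only: abs_le_square_iff)
  then have "int (gnorm (q - p)) \<le> int (2 * m\<^sup>2)" unfolding int_gnorm by simp
  then show ?thesis by linarith
qed

text \<open>The squared distance of two grid points is an integer of size at most
  \<open>2 * m\<^sup>2\<close>. For each value \<open>n\<close> the \<open>k\<close> pairs are
  chosen independently; \<open>n\<close> is read off at the index \<open>1\<close>, which exists as
  \<open>k \<ge> 1\<close>.\<close>

lemma dist_energy_square_grid:
  assumes "k \<ge> 1" "m = nat \<lfloor>sqrt (real N)\<rfloor>"
  shows "dist_energy k (square_grid N) = (\<Sum>n\<le>2 * m\<^sup>2. card (grid_pairs m n) ^ k)"
proof -
  define P where "P = square_grid N"
  define D where "D n = {t \<in> P \<times> P. dist (fst t) (snd t) = sqrt (real n)}" for n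
  have P: "P = plane_point ` int_grid m" by (simp add: P_def assms(2) square_grid_eq)
  have D: "D n = map_prod plane_point plane_point ` grid_pairs m n" for n
    by (force simp: D_def P grid_pairs_def dist_plane_point image_iff)
  have cardD: "card (D n) = card (grid_pairs m n)" for n
    unfolding D by (intro card_image inj_on_subset[OF prod.inj_map]) (simp_all add: inj_plane_point)
  have finD: "finite (D n)" for n by (simp add: D finite_grid_pairs)
  have "{t \<in> {1..k} \<rightarrow>\<^sub>E P \<times> P. \<forall>i\<in>{1..k}. \<forall>j\<in>{1..k}.
      dist (fst (t i)) (snd (t i)) = dist (fst (t j)) (snd (t j))} =
      (\<Union>n\<in>{..2 * m\<^sup>2}. {1..k} \<rightarrow>\<^sub>E D n)" (is "?L = ?R")
  proof (intro set_eqI iffI)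
    fix t assume t: "t \<in> ?L"
    have tE: "t \<in> {1..k} \<rightarrow>\<^sub>E P \<times> P" using t by blast
    have t_eq: "dist (fst (t i)) (snd (t i)) = dist (fst (t j)) (snd (t j))"
      if "i \<in> {1..k}" "j \<in> {1..k}" for i j
      using t that by blast
    have tP: "t i \<in> P \<times> P" if "i \<in> {1..k}" for i using tE that by (rule PiE_mem)
    obtain p q where pq: "p \<in> int_grid m" "q \<in> int_grid m" "t 1 = (plane_point p, plane_point q)"
    proof -
      have "t 1 \<in> P \<times> P" using tP[of 1] assms(1) by simp
      then obtain a b where "t 1 = (a, b)" "a \<in> P" "b \<in> P" by (elim SigmaE)
      then show thesis using that unfolding P by blast
    qed
    have "dist (fst (t i)) (snd (t i)) = sqrt (real (gnorm (q - p)))" if "i \<in> {1..k}" for i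
    proof -
      have "dist (fst (t i)) (snd (t i)) = dist (fst (t 1)) (snd (t 1))"
        by (rule t_eq) (use that assms(1) in auto)
      then show ?thesis unfolding pq(3) by (simp add: dist_plane_point)
    qed
    then have "t \<in> {1..k} \<rightarrow>\<^sub>E D (gnorm (q - p))"
      using tE tP by (auto simp: D_def PiE_iff)
    then show "t \<in> ?R" using gnorm_grid_diff_le[OF pq(1,2)] by blast
  next
    fix t assume "t \<in> ?R"
    then show "t \<in> ?L" by (auto simp: D_def PiE_iff)
  qed
  then have "dist_energy k P = card ?R" by (simp only: dist_energy_def)
  also have "\<dots> = (\<Sum>n\<le>2 * m\<^sup>2. card ({1..k} \<rightarrow>\<^sub>E D n))"
  proof (rule card_UN_disjoint)
    show "\<forall>n\<in>{..2 * m\<^sup>2}. \<forall>n'\<in>{..2 * m\<^sup>2}. n \<noteq> n' \<longrightarrow>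
      ({1..k} \<rightarrow>\<^sub>E D n) \<inter> ({1..k} \<rightarrow>\<^sub>E D n') = {}"
    proof (intro ballI impI equals0I)
      fix n n' t assume "n \<noteq> n'" "t \<in> ({1..k} \<rightarrow>\<^sub>E D n) \<inter> ({1..k} \<rightarrow>\<^sub>E D n')"
      moreover have "1 \<in> {1..k}" using assms(1) by simp
      ultimately have "t 1 \<in> D n" "t 1 \<in> D n'" by (blast dest: PiE_mem)+
      then show False using \<open>n \<noteq> n'\<close> by (simp add: D_def)
    qed
  qed (simp_all add: finite_PiE finD)
  also have "\<dots> = (\<Sum>n\<le>2 * m\<^sup>2. card (grid_pairs m n) ^ k)"
    by (simp add: card_PiE cardD)
  finally show ?thesis by (simp add: P_def)
qed

section \<open>Pairs of grid points at a given distance\<close>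

lemma card_sphere_le: "n > 0 \<Longrightarrow> card {z. gnorm z = n} \<le> 4 * card (sphere_quad n)"
proof -
  assume "n > 0"
  define U where "U = {1, - 1, GInt 0 1, GInt 0 (- 1)}"
  have "{z. gnorm z = n} \<subseteq> (\<lambda>(u, w). u * w) ` (U \<times> sphere_quad n)"
  proof
    fix z assume z: "z \<in> {z. gnorm z = n}"
    then have "z \<noteq> 0" using \<open>n > 0\<close> by auto
    then have "gnorm (unit_factor z) = 1"
      using gint_is_unit_iff unit_factor_is_unit by blast
    then have "unit_factor z \<in> U" using gnorm_eq_1_cases by (simp add: U_def)
    moreover have "normalize z \<in> sphere_quad n"
      using z \<open>z \<noteq> 0\<close> by (simp add: sphere_quad_def normalize_in_quad)
    ultimately show "z \<in> (\<lambda>(u, w). u * w) ` (U \<times> sphere_quad n)"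
      by (intro image_eqI[of _ _ "(unit_factor z, normalize z)"]) auto
  qed
  then have "card {z. gnorm z = n} \<le> card (U \<times> sphere_quad n)"
    by (intro surj_card_le) (simp_all add: U_def)
  also have "\<dots> \<le> 4 * card (sphere_quad n)"
    by (simp add: card_cartesian_product U_def card_insert_if)
  finally show ?thesis .
qed

lemma card_grid_pairs_0: "card (grid_pairs m 0) \<le> m\<^sup>2"
proof -
  have "grid_pairs m 0 \<subseteq> (\<lambda>p. (p, p)) ` int_grid m" by (auto simp: grid_pairs_def)
  then have "card (grid_pairs m 0) \<le> card (int_grid m)"
    by (intro surj_card_le finite_int_grid)
  then show ?thesis by (simp add: card_int_grid)
qed

text \<open>A pair is determined by its first point and its difference; the factor \<open>4\<close>
  counts the units.\<close>

lemma card_grid_pairs_le: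
  assumes "n > 0" shows "card (grid_pairs m n) \<le> m\<^sup>2 * (4 * card (sphere_quad n))"
proof -
  have fin: "finite {z. gnorm z = n}" by (rule finite_subset[OF _ finite_gnorm_le[of n]]) auto
  have "card (grid_pairs m n) \<le> card (int_grid m \<times> {z. gnorm z = n})"
    by (rule card_inj_on_le[of "\<lambda>(p, q). (p, q - p)"])
      (auto simp: inj_on_def grid_pairs_def finite_int_grid fin)
  also have "\<dots> = m\<^sup>2 * card {z. gnorm z = n}" by (simp add: card_cartesian_product card_int_grid)
  also have "\<dots> \<le> m\<^sup>2 * (4 * card (sphere_quad n))" using card_sphere_le[OF assms] by (rule mult_le_mono2)
  finally show ?thesis .
qed

text \<open>A point of the lower left subgrid of side \<open>h\<close> stays in the grid when moved
  by a first-quadrant vector of norm \<open>n\<close>, as both coordinates of that vector are at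
  most \<open>h\<close>.\<close>

lemma card_grid_pairs_ge:
  assumes "2 * h \<le> m" "n \<le> h\<^sup>2"
  shows "h\<^sup>2 * card (sphere_quad n) \<le> card (grid_pairs m n)"
proof -
  have "h\<^sup>2 * card (sphere_quad n) = card (int_grid h \<times> sphere_quad n)"
    by (simp add: card_cartesian_product card_int_grid)
  also have "\<dots> \<le> card (grid_pairs m n)"
  proof (rule card_inj_on_le[of "\<lambda>(p, z). (p, p + z)"])
    show "(\<lambda>(p, z). (p, p + z)) ` (int_grid h \<times> sphere_quad n) \<subseteq> grid_pairs m n"
    proof clarify
      fix p z assume p: "p \<in> int_grid h" and z: "z \<in> sphere_quad n"
      then obtain a b where ab: "z = lattice_point (a, b)"
        using quad_eq_lattice_point unfolding sphere_quad_def by blast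
      have "a\<^sup>2 + b\<^sup>2 \<le> h\<^sup>2" using z assms(2) by (simp add: sphere_quad_def ab gnorm_lattice_point)
      then have "a\<^sup>2 \<le> h\<^sup>2" "b\<^sup>2 \<le> h\<^sup>2" by linarith+
      then have "a \<le> h" "b \<le> h" by (simp_all only: power2_nat_le_eq_le)
      then show "(p, p + z) \<in> grid_pairs m n"
        using p z assms(1)
        by (auto simp: grid_pairs_def int_grid_def sphere_quad_def ab lattice_point_def)
    qed
  qed (auto simp: inj_on_def finite_grid_pairs)
  finally show ?thesis .
qed

section \<open>Upper and lower bounds for the energy\<close>

lemma Pow_eq_insert_empty: "Pow {1..<k::nat} = insert {} (Pow {1..<k} - {{}})"
  by auto

lemma card_Pow_minus_empty: "card (Pow {1..<k::nat} - {{}}) = 2 ^ (k - 1) - 1"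
  by (simp add: card_Pow)

text \<open>The summand \<open>1\<close> covers pairs at distance zero. In
  \<open>4 ^ (k + 1)\<close>, the power \<open>4 ^ k\<close> counts units and the last
  \<open>4\<close> is from the bound \<open>2 * (2 * N)\<close> in the tuple count, as the norms go
  up to \<open>2 * N\<close>. The base \<open>7 / 8\<close> bounds \<open>inverse_norm_sum\<close>
  relative to \<open>ln N\<close>.\<close>

lemma dist_energy_upper:
  assumes "k \<ge> 1" "N > 0" "ln (real N) \<ge> 120"
  shows "real (dist_energy k (square_grid N)) \<le>
    (1 + 4 ^ (k + 1) * (7 / 8) ^ (2 ^ (k - 1) - 1)) *
      (real N ^ (k + 1) * ln (real N) ^ (2 ^ (k - 1) - 1))"
proof -
  define m where "m = nat \<lfloor>sqrt (real N)\<rfloor>"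
  define q :: nat where "q = 2 ^ (k - 1) - 1"
  define I where "I = Pow {1..<k}"
  have I: "finite I" by (simp add: I_def)
  have "real m \<le> sqrt (real N)" by (simp add: m_def)
  then have "(real m)\<^sup>2 \<le> real N" by (metis of_nat_0_le_iff power_mono real_sqrt_pow2)
  then have mN: "m\<^sup>2 \<le> N" by (metis of_nat_le_iff of_nat_power)
  have N1: "real N \<ge> 1" using assms(2) by simp
  have "dist_energy k (square_grid N) = (\<Sum>n\<le>2 * m\<^sup>2. card (grid_pairs m n) ^ k)"
    by (rule dist_energy_square_grid[OF assms(1) m_def])
  also have "\<dots> = card (grid_pairs m 0) ^ k + (\<Sum>n=1..2 * m\<^sup>2. card (grid_pairs m n) ^ k)"
    by (simp add: atMost_atLeast0 sum.atLeast_Suc_atMost)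
  also have "\<dots> \<le> N ^ k + (\<Sum>n=1..2 * m\<^sup>2. N ^ k * 4 ^ k * card (tuples I n))"
  proof (intro add_mono sum_mono)
    show "card (grid_pairs m 0) ^ k \<le> N ^ k"
      using card_grid_pairs_0[of m] mN by (intro power_mono) auto
    fix n assume "n \<in> {1..2 * m\<^sup>2}"
    then have n: "n > 0" by simp
    have "card (grid_pairs m n) ^ k \<le> (m\<^sup>2 * (4 * card (sphere_quad n))) ^ k"
      by (intro power_mono card_grid_pairs_le n) simp
    also have "\<dots> \<le> (N * (4 * card (sphere_quad n))) ^ k"
      using mN by (intro power_mono mult_right_mono) auto
    also have "\<dots> = N ^ k * 4 ^ k * card (sphere_quad n) ^ k"
      by (simp add: power_mult_distrib)
    also have "\<dots> \<le> N ^ k * 4 ^ k * card (tuples I n)"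
      unfolding I_def by (intro mult_left_mono sphere_quad_power_le assms(1) n) simp
    finally show "card (grid_pairs m n) ^ k \<le> N ^ k * 4 ^ k * card (tuples I n)" .
  qed
  also have "(\<Sum>n=1..2 * m\<^sup>2. N ^ k * 4 ^ k * card (tuples I n)) \<le>
      (\<Sum>n=1..2 * N. N ^ k * 4 ^ k * card (tuples I n))"
    using mN by (intro sum_mono2) auto
  also have "\<dots> = N ^ k * 4 ^ k * card (tuples_le I (real (2 * N)))"
    using card_tuples_le_eq_sum[OF I, of "2 * N" "\<lambda>_. True"] by (simp add: sum_distrib_left)
  finally have "real (dist_energy k (square_grid N)) \<le>
      real (N ^ k + N ^ k * 4 ^ k * card (tuples_le I (real (2 * N))))"
    by (simp only: of_nat_le_iff add_left_mono)
  also have "\<dots> = real N ^ k + real N ^ k * 4 ^ k * real (card (tuples_le I (real (2 * N))))"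
    by simp
  also have "\<dots> \<le> real N ^ (k + 1) * ln (real N) ^ q +
      real N ^ k * 4 ^ k * (2 * real (2 * N) * (7 / 8 * ln (real N)) ^ q)"
  proof (intro add_mono mult_left_mono)
    have "1 * 1 \<le> real N * ln (real N) ^ q"
      using N1 assms(3) by (intro mult_mono one_le_power) auto
    then have "real N ^ k * 1 \<le> real N ^ k * (real N * ln (real N) ^ q)"
      by (intro mult_left_mono) auto
    then show "real N ^ k \<le> real N ^ (k + 1) * ln (real N) ^ q" by (simp add: mult_ac)
    \<comment> \<open>Since \<open>7 / 8 - 5 / 6 = 1 / 24\<close>, the condition
      \<open>ln N \<ge> 120\<close> leaves room for \<open>5\<close>, more than
      \<open>11 / 3 + 5 / 6 * ln 2\<close>.\<close>
    have "inverse_norm_sum (real (2 * N)) \<le> 11 / 3 + 5 / 6 * ln (real (2 * N))"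
      using N1 by (intro inverse_norm_sum_le) simp
    also have "ln (real (2 * N)) = ln 2 + ln (real N)" using N1 by (simp add: ln_mult)
    finally have "inverse_norm_sum (real (2 * N)) \<le> 7 / 8 * ln (real N)"
      using assms(3) ln_2_less_1 by argo
    then have "inverse_norm_sum (real (2 * N)) ^ q \<le> (7 / 8 * ln (real N)) ^ q"
      by (intro power_mono inverse_norm_sum_nonneg)
    \<comment> \<open>The empty set serves as the distinguished coordinate; the other
      \<open>q\<close> indices give the exponent of the logarithm.\<close>
    moreover have "real (card (tuples_le I (real (2 * N)))) \<le>
        2 * real (2 * N) * inverse_norm_sum (real (2 * N)) ^ q"
      using card_tuples_le_upper[of "I - {{}}" "{}" "real (2 * N)"] Pow_eq_insert_empty[of k]
        card_Pow_minus_empty[of k]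
      by (simp add: I_def q_def)
    ultimately show "real (card (tuples_le I (real (2 * N)))) \<le>
        2 * real (2 * N) * (7 / 8 * ln (real N)) ^ q"
      using mult_left_mono[of _ _ "2 * real (2 * N)"] by fastforce
  qed auto
  also have "\<dots> = (1 + 4 ^ (k + 1) * (7 / 8) ^ q) * (real N ^ (k + 1) * ln (real N) ^ q)"
    unfolding power_mult_distrib[of "7 / 8"] by (simp add: algebra_simps)
  finally show ?thesis by (simp only: q_def)
qed

text \<open>With \<open>h = 2 ^ (k - 1)\<close>, the first factor is \<open>16 * h\<^sup>2\<close>,
  only quadratic in \<open>h\<close>, while the second decays exponentially in \<open>h\<close>.
  This makes the upper constant uniform in \<open>k\<close>.\<close>

lemma constant_bounded:
  "\<exists>B>0. \<forall>k\<ge>1. 4 ^ (k + 1) * (7 / 8) ^ (2 ^ (k - 1) - 1) \<le> (B::real)"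
proof -
  have "(\<lambda>n. real n * (15 / 16) ^ n) \<longlonglongrightarrow> 0"
    by (rule powser_times_n_limit_0) simp
  then have "Bseq (\<lambda>n. real n * (15 / 16) ^ n)"
    by (intro convergent_imp_Bseq convergentI)
  then obtain B where B: "B > 0" "\<And>n. norm (real n * (15 / 16) ^ n) \<le> B"
    by (rule BseqE) blast
  have "4 ^ (k + 1) * (7 / 8) ^ (2 ^ (k - 1) - 1) \<le> 32 * B\<^sup>2" if k: "k \<ge> 1" for k :: nat
  proof -
    define h :: nat where "h = 2 ^ (k - 1)"
    have h: "h \<ge> 1" by (simp add: h_def)
    have "(4::real) ^ (k + 1) = 16 * (real h)\<^sup>2"
    proof -
      obtain j where "k = Suc j" using k by (cases k) auto
      then show ?thesis by (simp add: h_def power2_eq_square flip: power_mult_distrib)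
    qed
    moreover have "(7 / 8 :: real) ^ (h - 1) \<le> 2 * ((15 / 16) ^ h)\<^sup>2"
    proof -
      \<comment> \<open>The base \<open>15 / 16\<close> has square \<open>225 / 256\<close>, just
        above \<open>7 / 8\<close>, which lets the whole bound be written as a square.\<close>
      have "(7 / 8 :: real) ^ (h - 1) = 8 / 7 * (7 / 8) ^ h" using h by (cases h) auto
      also have "\<dots> \<le> 2 * ((15 / 16)\<^sup>2) ^ h"
        by (intro mult_mono power_mono) (auto simp: power2_eq_square)
      finally show ?thesis by (simp only: power_mult[symmetric] mult.commute)
    qed
    ultimately have "4 ^ (k + 1) * (7 / 8) ^ (h - 1) \<le>
        16 * (real h)\<^sup>2 * (2 * ((15 / 16) ^ h)\<^sup>2)"
      by (simp only:) (intro mult_left_mono, auto)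
    also have "\<dots> = 32 * (real h * (15 / 16) ^ h)\<^sup>2" by (simp add: power_mult_distrib)
    also have "\<dots> \<le> 32 * B\<^sup>2"
      using B(2)[of h] by (intro mult_left_mono power_mono) auto
    finally show ?thesis by (simp add: h_def)
  qed
  then show ?thesis using B(1) by (intro exI[of _ "32 * B\<^sup>2"]) auto
qed

text \<open>Only norms up to \<open>h\<^sup>2\<close> with \<open>h\<close> half the side are used.
  Each of them has at least \<open>h\<^sup>2 * card (sphere_quad n)\<close> pairs, and the
  \<open>k\<close>-th powers of the sphere sizes dominate the numbers of good tuples.\<close>

lemma dist_energy_lower:
  assumes "k \<ge> 1"
  shows "\<exists>c>0. \<exists>N0. \<forall>N\<ge>N0. real (dist_energy k (square_grid N)) \<ge>
    c * (real N ^ (k + 1) * ln (real N) ^ (2 ^ (k - 1) - 1))"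
proof -
  define q :: nat where "q = 2 ^ (k - 1) - 1"
  define I where "I = Pow {1..<k}"
  have I: "finite I" by (simp add: I_def)
  obtain c x0 where c: "c > 0" "\<And>x. x \<ge> x0 \<Longrightarrow>
      real (card {y \<in> tuples_le I x. good I y}) \<ge> c * x * ln x ^ q"
    using card_good_tuples_lower[of "I - {{}}" "{}"] Pow_eq_insert_empty[of k]
      card_Pow_minus_empty[of k] by (auto simp: I_def q_def)
  \<comment> \<open>The factors \<open>1 / 16\<close> come from
    \<open>h\<^sup>2 \<ge> N / 16\<close>, and \<open>1 / 2\<close> from
    \<open>ln (N / 16) \<ge> ln N / 2\<close>, which holds for
    \<open>N \<ge> 16\<^sup>2 = 256\<close>.\<close>
  define c' where "c' = c * (1 / 16) ^ (k + 1) * (1 / 2) ^ q"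
  have "real (dist_energy k (square_grid N)) \<ge> c' * (real N ^ (k + 1) * ln (real N) ^ q)"
    if N: "N \<ge> max 256 (nat \<lceil>16 * x0\<rceil>)" for N
  proof -
    define m where "m = nat \<lfloor>sqrt (real N)\<rfloor>"
    define h where "h = m div 2"
    have N256: "real N \<ge> 256" and Nx: "real N / 16 \<ge> x0" using N by linarith+
    have "sqrt (real N) \<ge> 16" using N256 by (intro real_le_rsqrt) simp
    then have "sqrt (real N) / 4 \<le> real h" unfolding h_def m_def by linarith
    then have "(sqrt (real N) / 4)\<^sup>2 \<le> (real h)\<^sup>2" by (intro power_mono) auto
    then have hN: "real N / 16 \<le> real (h\<^sup>2)" by (simp add: power_divide)
    have "ln (real (h\<^sup>2)) \<ge> ln (real N / 16)" using hN N256 by (intro ln_mono) auto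
    moreover have "ln (real N / 16) \<ge> 1 / 2 * ln (real N)"
    proof -
      have "2 * ln (16::real) = ln (16\<^sup>2)" by (simp only: ln_realpow)
      also have "\<dots> \<le> ln (real N)" using N256 by (intro ln_mono) auto
      finally have "2 * ln (16::real) \<le> ln (real N)" .
      then show ?thesis using N256 by (simp add: ln_div)
    qed
    ultimately have lnh: "1 / 2 * ln (real N) \<le> ln (real (h\<^sup>2))" by linarith
    have "c' * (real N ^ (k + 1) * ln (real N) ^ q) =
        (real N / 16) ^ k * (c * (real N / 16) * (1 / 2 * ln (real N)) ^ q)"
      by (simp add: c'_def power_mult_distrib power_divide mult_ac)
    also have "\<dots> \<le> real (h\<^sup>2) ^ k * (c * real (h\<^sup>2) * ln (real (h\<^sup>2)) ^ q)"
      using hN lnh c(1) N256 by (intro mult_mono power_mono mult_nonneg_nonneg zero_le_power) auto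
    also have "\<dots> \<le> real (h\<^sup>2) ^ k * real (card {y \<in> tuples_le I (real (h\<^sup>2)). good I y})"
      using hN Nx by (intro mult_left_mono c(2)) auto
    also have "\<dots> = real ((h\<^sup>2) ^ k * (\<Sum>n=1..h\<^sup>2. card {y \<in> tuples I n. good I y}))"
      unfolding card_tuples_le_eq_sum[OF I] by simp
    also have "\<dots> \<le> real (dist_energy k (square_grid N))"
    proof (rule of_nat_mono)
      have "2 * h \<le> m" by (simp add: h_def)
      have "(h\<^sup>2) ^ k * (\<Sum>n=1..h\<^sup>2. card {y \<in> tuples I n. good I y}) \<le>
          (h\<^sup>2) ^ k * (\<Sum>n=1..h\<^sup>2. card (sphere_quad n) ^ k)"
        unfolding I_def by (intro mult_left_mono sum_mono card_good_tuples_le assms) simp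
      also have "\<dots> = (\<Sum>n=1..h\<^sup>2. (h\<^sup>2 * card (sphere_quad n)) ^ k)"
        by (simp add: sum_distrib_left power_mult_distrib)
      also have "\<dots> \<le> (\<Sum>n=1..h\<^sup>2. card (grid_pairs m n) ^ k)"
        using \<open>2 * h \<le> m\<close> by (intro sum_mono power_mono card_grid_pairs_ge) auto
      also have "\<dots> \<le> (\<Sum>n\<le>2 * m\<^sup>2. card (grid_pairs m n) ^ k)"
      proof (rule sum_mono2)
        have "h\<^sup>2 \<le> m\<^sup>2" using \<open>2 * h \<le> m\<close> by (intro power_mono) auto
        then have "h\<^sup>2 \<le> 2 * m\<^sup>2" by linarith
        then show "{1..h\<^sup>2} \<subseteq> {..2 * m\<^sup>2}" by (meson atLeastAtMost_iff atMost_iff order.trans subsetI)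
      qed auto
      also have "\<dots> = dist_energy k (square_grid N)"
        by (rule dist_energy_square_grid[OF assms m_def, symmetric])
      finally show "(h\<^sup>2) ^ k * (\<Sum>n=1..h\<^sup>2. card {y \<in> tuples I n. good I y}) \<le>
        dist_energy k (square_grid N)" .
    qed
    finally show ?thesis .
  qed
  moreover have "c' > 0" using c(1) by (simp add: c'_def)
  ultimately show ?thesis unfolding q_def by blast
qed

theorem theorem3p4:
  "\<exists>C::real. C > 0 \<and>
     (\<forall>k::nat. k \<ge> 2 \<longrightarrow>
       (\<exists>c::real. c > 0 \<and>
         (\<exists>N\<^sub>0::nat. \<forall>N::nat. N \<ge> N\<^sub>0 \<longrightarrow>
            real N ^ (k + 1) * ln (real N) ^ (2 ^ (k - 1) - 1)
              \<ge> C * real (dist_energy k (square_grid N)) \<and>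
            real (dist_energy k (square_grid N))
              \<ge> c * (real N ^ (k + 1) * ln (real N) ^ (2 ^ (k - 1) - 1)))))"
proof -
  obtain B :: real where B: "B > 0"
    "\<And>k::nat. k \<ge> 1 \<Longrightarrow> 4 ^ (k + 1) * (7 / 8) ^ (2 ^ (k - 1) - 1) \<le> B"
    using constant_bounded by blast
  show ?thesis
  \<comment> \<open>The upper bound has a factor of at most \<open>1 + B\<close> for every
    \<open>k\<close>, so this witness can be fixed before \<open>k\<close>.\<close>
  proof (rule exI[of _ "1 / (1 + B)"], intro conjI allI impI)
    show "1 / (1 + B) > 0" using B(1) by simp
    fix k :: nat assume "k \<ge> 2"
    then have k: "k \<ge> 1" by simp
    then obtain c N0 where c: "c > 0" "\<And>N. N \<ge> N0 \<Longrightarrow> real (dist_energy k (square_grid N)) \<ge>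
        c * (real N ^ (k + 1) * ln (real N) ^ (2 ^ (k - 1) - 1))"
      using dist_energy_lower by blast
    have "1 / (1 + B) * real (dist_energy k (square_grid N)) \<le>
        real N ^ (k + 1) * ln (real N) ^ (2 ^ (k - 1) - 1)"
      if N: "N \<ge> nat \<lceil>exp (120::real)\<rceil>" for N
    proof -
      define X where "X = real N ^ (k + 1) * ln (real N) ^ (2 ^ (k - 1) - 1)"
      have exp: "real N \<ge> exp 120" using N by linarith
      then have "real N > 0" by (rule order.strict_trans2[OF exp_gt_zero])
      then have ln: "N > 0" "ln (real N) \<ge> 120" using exp by (simp_all add: ln_ge_iff)
      have "real (dist_energy k (square_grid N)) \<le>
          (1 + 4 ^ (k + 1) * (7 / 8) ^ (2 ^ (k - 1) - 1)) * X"
        unfolding X_def by (rule dist_energy_upper[OF k ln])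
      also have "\<dots> \<le> (1 + B) * X"
        using B(2)[OF k] ln(2) by (intro mult_right_mono) (auto simp: X_def)
      finally show ?thesis using B(1) by (simp add: X_def field_simps)
    qed
    then show "\<exists>c::real. c > 0 \<and>
         (\<exists>N\<^sub>0::nat. \<forall>N::nat. N \<ge> N\<^sub>0 \<longrightarrow>
            real N ^ (k + 1) * ln (real N) ^ (2 ^ (k - 1) - 1)
              \<ge> 1 / (1 + B) * real (dist_energy k (square_grid N)) \<and>
            real (dist_energy k (square_grid N))
              \<ge> c * (real N ^ (k + 1) * ln (real N) ^ (2 ^ (k - 1) - 1)))"
      using c by (metis max.bounded_iff)
  qed
qed

end
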